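(* Let $G$ be a $C_6$-free triangle-free planar graph on $n$ vertices with minimum degree $\delta(G)\ge 3$, and let $e_G$ be its number of edges. Then $$e_G\le \left\lfloor \frac{9}{5}n-4\right\rfloor.$$ Moreover, equality holds for infinitely many integers $n$: for infinitely many $n$ there exists a $C_6$-free triangle-free planar graph on $n$ vertices with minimum degree at least $3$ and exactly $\left\lfloor \frac{9}{5}n-4\right\rfloor$ edges.
   Context: All graphs are finite, undirected and simple. $C_\ell$ denotes the cycle of length $\ell$; $G$ is $H$-free if it does not contain $H$ as a (not necessarily induced) subgraph. *)

theory Defs
  imports "HOL-Analysis.Analysis"
begin

record 'a ugraph =
  verts :: "'a set"
  edges :: "'a set set"

definition simple_graph :: "'a ugraph \<Rightarrow> bool" where
  "simple_graph G \<longleftrightarrow> finite (verts G) \<and> (\<forall>e\<in>edges G. e \<subseteq> verts G \<and> card e = 2)"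

definition degree :: "'a ugraph \<Rightarrow> 'a \<Rightarrow> nat" where
  "degree G v = card {e \<in> edges G. v \<in> e}"

text \<open>Unspecified for a graph without vertices, because the minimum of the empty set is.\<close>

definition min_degree :: "'a ugraph \<Rightarrow> nat" where
  "min_degree G = Min (degree G ` verts G)"

text \<open>The subgraph copy of \<open>H\<close> need not be induced: \<open>G\<close> may have further edges between
  the image vertices.\<close>

definition contains_subgraph :: "'a ugraph \<Rightarrow> 'b ugraph \<Rightarrow> bool" where
  "contains_subgraph G H \<longleftrightarrow>
    (\<exists>f. inj_on f (verts H) \<and> f ` verts H \<subseteq> verts G \<and> (\<forall>e\<in>edges H. f ` e \<in> edges G))"

definition subgraph_free :: "'b ugraph \<Rightarrow> 'a ugraph \<Rightarrow> bool" where
  "subgraph_free H G \<longleftrightarrow> \<not> contains_subgraph G H"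

text \<open>Meaningful for \<open>l \<ge> 3\<close> only; smaller \<open>l\<close> give degenerate edge sets.\<close>

definition cycle_graph :: "nat \<Rightarrow> nat ugraph" where
  "cycle_graph l = \<lparr>verts = {..<l}, edges = {{i, (i + 1) mod l} | i. i < l}\<rparr>"

text \<open>A drawing in the Euclidean plane, represented by the type of complex numbers: vertices
  are distinct points, an edge is an arc (an injective path) joining its two ends, and the
  interior of an edge meets no vertex and no other edge. The conditions on \<open>c e\<close> do not depend on
  the direction in which the arc is traversed.\<close>

definition plane_drawing ::
    "'a ugraph \<Rightarrow> ('a \<Rightarrow> complex) \<Rightarrow> ('a set \<Rightarrow> real \<Rightarrow> complex) \<Rightarrow> bool" where
  "plane_drawing G p c \<longleftrightarrow>
    inj_on p (verts G) \<and>
    (\<forall>e\<in>edges G. arc (c e) \<and> {pathstart (c e), pathfinish (c e)} = p ` e) \<and>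
    (\<forall>e\<in>edges G. c e ` {0<..<1} \<inter> p ` verts G = {}) \<and>
    (\<forall>e\<in>edges G. \<forall>e'\<in>edges G. e \<noteq> e' \<longrightarrow> c e ` {0<..<1} \<inter> path_image (c e') = {})"

definition planar :: "'a ugraph \<Rightarrow> bool" where
  "planar G \<longleftrightarrow> (\<exists>p c. plane_drawing G p c)"

end

theory Submission
  imports Defs
begin

text \<open>Write \<open>n\<close>, \<open>e\<close> and \<open>f\<close> for the numbers of vertices, edges and faces, and \<open>q\<close> for the number of
  faces bounded by a 4-cycle. Every other face has at least five boundary edges, and an edge bounds at
  most two faces, so \<open>5 f - q \<le> 2 e\<close>. Two 4-faces with a common edge would form a 6-cycle or a triangle,
  or force a vertex of degree 2. Hence a vertex of degree \<open>d \<ge> 3\<close> lies on at most \<open>\<lfloor>d / 2\<rfloor> \<le> d - 2\<close>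
  of the 4-faces, and \<open>4 q \<le> 2 e - 2 n\<close>. With Euler's inequality \<open>e + 2 \<le> n + f\<close> this gives
  \<open>5 e \<le> 9 n - 20\<close>.

  Faces are connected components of the complement of the drawing. Euler's inequality comes from the
  Jordan curve theorem, and the two sides of an edge from Janiszewski's theorem. No rotation system and no
  facial walk is used: the boundary of a face is the set of edges in its closure, and it contains a cycle
  because forests do not separate the plane.

  The bound is attained by tubes. Each is a stack of rings of four 4-faces that touch cyclically at
  vertices. Consecutive rings share two vertices, all faces between them are pentagons, and pentagons join
  a further 4-cycle to each of the two outermost rings. A tube has a two-page book drawing.\<close>

text \<open>All counts are one-sided. An edge may have the same face on both sides, so the boundary
  of a face is a set without multiplicities; this can only lower the number of edge-face incidences.
  For a disconnected graph Euler's relation becomes a strict inequality, again in the useful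
  direction.

  Equality requires \<open>d div 2 = d - 2\<close> at every vertex. Hence all degrees are 3 or 4, a
  vertex of degree d lies on exactly d - 2 of the 4-faces, and every other face is a pentagon. The
  tube is built to meet these demands: with 20 M + 10 vertices and 36 M + 14 edges it satisfies 5 e
  = 9 n - 20 exactly, and the floor loses nothing.

  Triangles and hexagons in a tube of arbitrary length are excluded by locality. Adjacent labels
  differ by at most 16, so a short cycle touches few periods and either avoids the top or can be
  shifted down. Induction reduces the question to the tube with five periods, where an exhaustive
  search decides it.\<close>

subsection \<open>Arcs in the complement of a compact set\<close>

text \<open>Otherwise the inverse of the arc would embed a nonempty open set of the plane into the
  line, against invariance of dimension.\<close>

lemma interior_path_image_arc:
  fixes \<gamma> :: "real \<Rightarrow> complex"
  assumes "arc \<gamma>"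
  shows "interior (path_image \<gamma>) = {}"
proof (rule ccontr)
  assume ne: "interior (path_image \<gamma>) \<noteq> {}"
  obtain h where h: "homeomorphism {0..1} (path_image \<gamma>) \<gamma> h"
    using homeomorphism_arc[OF assms] .
  have "inj_on h (path_image \<gamma>)"
    using h unfolding homeomorphism_def by (metis inj_on_inverseI)
  then have "inj_on h (interior (path_image \<gamma>))"
    using interior_subset inj_on_subset by blast
  moreover have "continuous_on (interior (path_image \<gamma>)) h"
    using h continuous_on_subset interior_subset unfolding homeomorphism_def by blast
  ultimately have "DIM(complex) \<le> DIM(real)"
    using ne invariance_of_dimension[of "interior (path_image \<gamma>)" h] by simp
  then show False by simp
qed

lemma path_component_arc:
  fixes S :: "complex set"
  assumes "path_component S x y" "x \<noteq> y"
  obtains g where "arc g" "path_image g \<subseteq> S" "pathstart g = x" "pathfinish g = y"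
proof -
  have pc: "path_connected (path_component_set S x)" by simp
  have "x \<in> path_component_set S x" "y \<in> path_component_set S x"
    using assms path_component_mem(1)[OF assms(1)] by (auto intro: path_component_refl)
  with pc \<open>x \<noteq> y\<close> obtain g where "arc g" "path_image g \<subseteq> path_component_set S x"
      "pathstart g = x" "pathfinish g = y"
    unfolding path_connected_arcwise by meson
  moreover have "path_component_set S x \<subseteq> S"
    by (rule path_component_subset)
  ultimately show thesis
    using that by blast
qed

text \<open>Each member of the family lies in a single path component, so the component and its
  remainder are both finite unions of members. For an arbitrary compact set a path component need
  not be closed; the finite family secures this.\<close>

lemma compact_path_component_Union:
  fixes \<F> :: "complex set set"
  assumes fin: "finite \<F>" and F: "\<And>M. M \<in> \<F> \<Longrightarrow> compact M \<and> path_connected M"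
  defines "K \<equiv> \<Union>\<F>"
  shows "compact (path_component_set K a)" "compact (K - path_component_set K a)"
proof -
  define P where "P = path_component_set K a"
  have meet: "M \<subseteq> P" if "M \<in> \<F>" "M \<inter> P \<noteq> {}" for M
  proof -
    obtain z where z: "z \<in> M" "path_component K a z"
      using \<open>M \<inter> P \<noteq> {}\<close> unfolding P_def by auto
    show ?thesis
    proof
      fix w assume "w \<in> M"
      then have "path_component M z w"
        using F[OF \<open>M \<in> \<F>\<close>] z path_connected_component by blast
      then have "path_component K z w"
        using \<open>M \<in> \<F>\<close> unfolding K_def by (meson Union_upper path_component_of_subset)
      with z show "w \<in> P"
        unfolding P_def by (auto intro: path_component_trans)
    qed
  qed
  have PK: "P \<subseteq> K"
    unfolding P_def by (simp add: path_component_subset)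
  have 1: "P = \<Union>{M \<in> \<F>. M \<inter> P \<noteq> {}}"
    using meet PK unfolding K_def by blast
  have 2: "K - P = \<Union>{M \<in> \<F>. M \<inter> P = {}}"
    using meet unfolding K_def by blast
  show "compact (path_component_set K a)"
    unfolding P_def[symmetric] by (subst 1) (use fin F in \<open>auto intro: compact_Union\<close>)
  show "compact (K - path_component_set K a)"
    unfolding P_def[symmetric] by (subst 2) (use fin F in \<open>auto intro: compact_Union\<close>)
qed

text \<open>A connected set that starts in \<open>F\<close> and avoids \<open>Y\<close> cannot cross
  the frontier of \<open>F\<close>. This recognises a face in the complement of only a part of the
  drawing.\<close>

lemma components_complementI:
  fixes F Y :: "'a::topological_space set"
  assumes "open F" "connected F" "F \<noteq> {}" "F \<inter> Y = {}" "frontier F \<subseteq> Y"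
  shows "F \<in> components (- Y)"
proof -
  obtain x where "x \<in> F" using assms by blast
  have "connected_component_set (- Y) x = F"
  proof (rule connected_component_unique)
    fix W assume W: "x \<in> W" "W \<subseteq> - Y" "connected W"
    then have "W \<inter> frontier F = {}" using assms by blast
    with W \<open>x \<in> F\<close> show "W \<subseteq> F"
      using connected_Int_frontier[of W F] by blast
  qed (use assms \<open>x \<in> F\<close> in auto)
  with \<open>x \<in> F\<close> assms show ?thesis
    unfolding components_iff by blast
qed

lemma component_eqI:
  assumes "F \<in> components S" "F' \<in> components S" "x \<in> F" "y \<in> F'" "connected_component S x y"
  shows "F = F'"
  using assms unfolding components_iff by (metis connected_component_eq mem_Collect_eq)

lemma component_absorb:
  assumes "F \<in> components S" "x \<in> F" "connected_component S x y"
  shows "y \<in> F"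
  using assms unfolding components_iff by (auto intro: connected_component_trans)

text \<open>The arc \<open>\<gamma>\<close> is closed up inside the obstacle \<open>K\<close> to a
  Jordan curve \<open>C\<close>. Then \<open>K \<union> C = K \<union> path_image \<gamma>\<close>,
  while \<open>K \<inter> C\<close> is the image of \<open>\<beta>\<close> and thus connected, as
  Janiszewski's theorem demands.\<close>

locale arc_chord =
  fixes \<gamma> \<beta> :: "real \<Rightarrow> complex" and K :: "complex set"
  assumes arc: "arc \<gamma>" "arc \<beta>"
    and ends: "pathstart \<beta> = pathfinish \<gamma>" "pathfinish \<beta> = pathstart \<gamma>"
    and K: "compact K" "path_image \<beta> \<subseteq> K" "K \<inter> path_image \<gamma> = {pathstart \<gamma>, pathfinish \<gamma>}"
begin

definition "C = path_image \<gamma> \<union> path_image \<beta>"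

lemma C_eq: "C = path_image (\<gamma> +++ \<beta>)"
  unfolding C_def using ends by (simp add: path_image_join)

lemma simple_loop: "simple_path (\<gamma> +++ \<beta>)" "pathfinish (\<gamma> +++ \<beta>) = pathstart (\<gamma> +++ \<beta>)"
proof -
  show "simple_path (\<gamma> +++ \<beta>)"
    using arc ends K by (intro simple_path_join_loop) auto
qed (simp add: ends)

lemma Jordan:
  "connected (inside C)" "connected (outside C)" "inside C \<inter> outside C = {}"
  "inside C \<union> outside C = - C" "frontier (inside C) = C" "frontier (outside C) = C"
  using Jordan_inside_outside[OF simple_loop] unfolding C_eq[symmetric] by simp_all

lemma same_side:
  assumes D: "connected D" "D \<inter> K = {}"
    and pq: "p \<in> D" "q \<in> D" "p \<in> inside C \<and> q \<in> inside C \<or> p \<in> outside C \<and> q \<in> outside C"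
  shows "connected_component (- (K \<union> path_image \<gamma>)) p q"
proof -
  have "connected_component (- (K \<union> C)) p q"
  proof (rule Janiszewski)
    show "compact K" by (rule K)
    show "closed C"
      unfolding C_def by (simp add: arc arc_imp_path closed_Un closed_path_image)
    have "K \<inter> C = {pathfinish \<beta>, pathstart \<beta>} \<union> path_image \<beta>"
      using K(2,3) ends unfolding C_def Int_Un_distrib by (simp add: Int_absorb1)
    then have "K \<inter> C = path_image \<beta>"
      by auto
    then show "connected (K \<inter> C)"
      by (simp add: arc arc_imp_path connected_path_image)
    have "D \<subseteq> - K"
      using D(2) by blast
    then show "connected_component (- K) p q"
      using D(1) pq(1,2) unfolding connected_component_def by metis
    have "inside C \<subseteq> - C" "outside C \<subseteq> - C"
      using Jordan(4) by blast+
    then show "connected_component (- C) p q"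
      using Jordan(1,2) pq(3) unfolding connected_component_def by metis
  qed
  moreover have "K \<union> C = K \<union> path_image \<gamma>"
    using K(2) unfolding C_def by blast
  ultimately show ?thesis by simp
qed

lemma separated:
  assumes "p \<in> inside C" "q \<in> outside C"
  shows "\<not> connected_component (- (K \<union> path_image \<gamma>)) p q"
proof
  assume "connected_component (- (K \<union> path_image \<gamma>)) p q"
  then obtain W where W: "connected W" "W \<subseteq> - (K \<union> path_image \<gamma>)" "p \<in> W" "q \<in> W"
    unfolding connected_component_def by blast
  have "q \<notin> inside C"
    using assms Jordan(3) by blast
  then have "W \<inter> frontier (inside C) \<noteq> {}"
    using W assms by (intro connected_Int_frontier) auto
  then have "W \<inter> C \<noteq> {}"
    using Jordan(5) by simp
  then show False
    using W(2) K(2) unfolding C_def by blast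
qed

lemma sides_cover:
  assumes "D \<inter> K = {}"
  shows "D - path_image \<gamma> = D \<inter> inside C \<union> D \<inter> outside C"
proof -
  have "D - path_image \<gamma> = D \<inter> - C"
    using assms K(2) unfolding C_def by blast
  also have "\<dots> = D \<inter> (inside C \<union> outside C)"
    using Jordan(4) by simp
  finally show ?thesis by blast
qed

lemma sides_dense:
  assumes "open D"
  shows "D \<inter> path_image \<gamma> \<subseteq> closure (D \<inter> inside C)" "D \<inter> path_image \<gamma> \<subseteq> closure (D \<inter> outside C)"
proof -
  have 1: "C \<subseteq> closure (inside C)" "C \<subseteq> closure (outside C)"
    using Jordan(5,6) unfolding frontier_def by blast+
  have "path_image \<gamma> \<subseteq> C" unfolding C_def by blast
  with 1 have "D \<inter> path_image \<gamma> \<subseteq> D \<inter> closure (inside C)" "D \<inter> path_image \<gamma> \<subseteq> D \<inter> closure (outside C)"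
    by blast+
  then show "D \<inter> path_image \<gamma> \<subseteq> closure (D \<inter> inside C)" "D \<inter> path_image \<gamma> \<subseteq> closure (D \<inter> outside C)"
    using open_Int_closure_subset[OF assms, of "inside C"] open_Int_closure_subset[OF assms, of "outside C"]
    by (meson order_trans)+
qed

end

text \<open>Janiszewski's theorem is applied twice: \<open>K1\<close> meets the arc in one point,
  and then \<open>K2\<close> meets \<open>K1 \<union> path_image \<gamma>\<close> in one point. So
  an arc that bridges two separate obstacles does not separate points that were together
  before.\<close>

lemma arc_bridge_same_side:
  fixes \<gamma> :: "real \<Rightarrow> complex"
  assumes "arc \<gamma>" "compact K1" "compact K2" "K1 \<inter> K2 = {}"
    and K: "K1 \<inter> path_image \<gamma> = {a}" "K2 \<inter> path_image \<gamma> = {b}"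
    and D: "connected D" "D \<inter> (K1 \<union> K2) = {}" "p \<in> D - path_image \<gamma>" "q \<in> D - path_image \<gamma>"
  shows "connected_component (- (K1 \<union> K2 \<union> path_image \<gamma>)) p q"
proof -
  have cl: "closed (path_image \<gamma>)" by (simp add: assms arc_imp_path closed_path_image)
  have conn: "connected_component (- K1) p q" "connected_component (- K2) p q"
    using D unfolding connected_component_def by blast+
  have "connected (- path_image \<gamma>)"
    by (simp add: connected_arc_complement[OF \<open>arc \<gamma>\<close>])
  then have "connected_component (- path_image \<gamma>) p q"
    using D unfolding connected_component_def by blast
  then have "connected_component (- (K1 \<union> path_image \<gamma>)) p q"
    by (intro Janiszewski[OF \<open>compact K1\<close>] cl conn) (simp_all add: K)
  moreover have "K2 \<inter> (K1 \<union> path_image \<gamma>) = {b}"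
    using assms by blast
  ultimately have "connected_component (- (K2 \<union> (K1 \<union> path_image \<gamma>))) p q"
    using assms(2,3) cl conn(2)
    by (intro Janiszewski[OF \<open>compact K2\<close>]) (simp_all only: compact_imp_closed closed_Un connected_sing)
  then show ?thesis by (simp add: Un_ac)
qed

text \<open>If \<open>K\<close> joins the two ends of the arc, the sides are the inside and the
  outside of a Jordan curve. If it does not, the arc is a bridge, and \<open>P\<close> and
  \<open>Q\<close> are both the whole of \<open>D - path_image \<gamma>\<close>.\<close>

lemma arc_sides:
  fixes \<gamma> :: "real \<Rightarrow> complex"
  assumes \<gamma>: "arc \<gamma>"
    and fin: "finite \<F>" and F: "\<And>M. M \<in> \<F> \<Longrightarrow> compact M \<and> path_connected M"
    and K: "K = \<Union>\<F>" "K \<inter> path_image \<gamma> = {pathstart \<gamma>, pathfinish \<gamma>}"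
    and x: "x \<in> path_image \<gamma> - K"
  obtains D P Q where "open D" "x \<in> D" "D - path_image \<gamma> = P \<union> Q" "D \<inter> K = {}"
    "\<And>p q. p \<in> P \<Longrightarrow> q \<in> P \<Longrightarrow> connected_component (- (K \<union> path_image \<gamma>)) p q"
    "\<And>p q. p \<in> Q \<Longrightarrow> q \<in> Q \<Longrightarrow> connected_component (- (K \<union> path_image \<gamma>)) p q"
    "D \<inter> path_image \<gamma> \<subseteq> closure P" "D \<inter> path_image \<gamma> \<subseteq> closure Q"
proof -
  have cK: "compact K" unfolding K using fin F by (auto intro: compact_Union)
  define a b where "a = pathstart \<gamma>" and "b = pathfinish \<gamma>"
  have "open (- K)" using cK by (simp add: compact_imp_closed open_Compl)
  with x obtain r where r: "r > 0" "ball x r \<subseteq> - K"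
    by (meson ComplI DiffD2 openE)
  define D where "D = ball x r"
  have D: "open D" "connected D" "x \<in> D" "D \<inter> K = {}"
    using r unfolding D_def by auto
  have "a \<noteq> b" using \<gamma> arc_distinct_ends[of \<gamma>] unfolding a_def b_def by auto
  have abK: "a \<in> K" "b \<in> K" using K unfolding a_def b_def by auto
  show thesis
  proof (cases "path_component K b a")
    case True
    then obtain \<beta> where \<beta>: "arc \<beta>" "path_image \<beta> \<subseteq> K" "pathstart \<beta> = b" "pathfinish \<beta> = a"
      using path_component_arc \<open>a \<noteq> b\<close> by metis
    then interpret arc_chord \<gamma> \<beta> K
      using \<gamma> cK K by unfold_locales (auto simp: a_def b_def)
    show thesis
    proof (rule that)
      show "D - path_image \<gamma> = D \<inter> inside C \<union> D \<inter> outside C"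
        by (rule sides_cover) (rule D)
      show "connected_component (- (K \<union> path_image \<gamma>)) p q"
        if "p \<in> D \<inter> inside C" "q \<in> D \<inter> inside C" for p q
        using same_side[OF D(2,4), of p q] that by blast
      show "connected_component (- (K \<union> path_image \<gamma>)) p q"
        if "p \<in> D \<inter> outside C" "q \<in> D \<inter> outside C" for p q
        using same_side[OF D(2,4), of p q] that by blast
    qed (fact D sides_dense[OF D(1)])+
  next
    case False
    define K1 where "K1 = path_component_set K a"
    define K2 where "K2 = K - K1"
    have cc: "compact K1" "compact K2"
      using compact_path_component_Union[OF fin F, folded K] unfolding K1_def K2_def by auto
    have KK: "K1 \<union> K2 = K" "K1 \<inter> K2 = {}"
      unfolding K1_def K2_def by (auto dest: path_component_mem)
    have a1: "a \<in> K1" unfolding K1_def by (simp add: abK path_component_refl)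
    have b2: "b \<in> K2" using False abK unfolding K1_def K2_def by (auto dest: path_component_sym)
    have i: "K1 \<inter> path_image \<gamma> = {a}" "K2 \<inter> path_image \<gamma> = {b}"
      using K(2) KK a1 b2 unfolding a_def[symmetric] b_def[symmetric] by blast+
    have conn: "connected_component (- (K \<union> path_image \<gamma>)) p q"
      if "p \<in> D - path_image \<gamma>" "q \<in> D - path_image \<gamma>" for p q
      using arc_bridge_same_side[OF \<gamma> cc KK(2) i D(2) _ that] D by (simp add: KK)
    have "D \<subseteq> closure (D - path_image \<gamma>)"
    proof -
      have "closure (- path_image \<gamma>) = UNIV"
        using interior_path_image_arc[OF \<gamma>] by (simp add: closure_complement)
      then show ?thesis
        using open_Int_closure_subset[OF \<open>open D\<close>, of "- path_image \<gamma>"] by (simp add: Diff_eq)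
    qed
    then have dense: "D \<inter> path_image \<gamma> \<subseteq> closure (D - path_image \<gamma>)"
      by blast
    show thesis
      by (rule that[OF D(1,3) _ D(4) conn conn dense dense]) simp_all
  qed
qed

subsection \<open>Faces of a plane drawing\<close>

locale plane_graph =
  fixes G :: "'a ugraph" and p :: "'a \<Rightarrow> complex" and c :: "'a set \<Rightarrow> real \<Rightarrow> complex"
  assumes simple: "simple_graph G" and drawing: "plane_drawing G p c"
begin

definition eint :: "'a set \<Rightarrow> complex set" where
  "eint e = c e ` {0<..<1}"

definition curves :: "'a set set \<Rightarrow> complex set" where
  "curves E' = (\<Union>e\<in>E'. path_image (c e))"

definition draw :: "'a set set \<Rightarrow> complex set" where
  "draw E' = p ` verts G \<union> curves E'"

abbreviation faces :: "complex set set" where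
  "faces \<equiv> components (- draw (edges G))"

definition bd :: "complex set \<Rightarrow> 'a set set" where
  "bd F = {e \<in> edges G. eint e \<subseteq> closure F}"

lemma finite_verts: "finite (verts G)"
  using simple by (simp add: simple_graph_def)

lemma edge_subset: "e \<in> edges G \<Longrightarrow> e \<subseteq> verts G"
  using simple by (simp add: simple_graph_def)

lemma finite_edges: "finite (edges G)"
  by (rule finite_subset[of _ "Pow (verts G)"]) (auto dest: edge_subset simp: finite_verts)

lemma edgeE:
  assumes "e \<in> edges G"
  obtains u v where "e = {u, v}" "u \<noteq> v" "u \<in> verts G" "v \<in> verts G"
  using assms simple unfolding simple_graph_def card_2_iff by (metis insert_subset)

lemma inj_p: "inj_on p (verts G)"
  and arc_c: "e \<in> edges G \<Longrightarrow> arc (c e)"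
  and ends_c: "e \<in> edges G \<Longrightarrow> {pathstart (c e), pathfinish (c e)} = p ` e"
  and inner_verts: "e \<in> edges G \<Longrightarrow> eint e \<inter> p ` verts G = {}"
  and inner_curve: "e \<in> edges G \<Longrightarrow> e' \<in> edges G \<Longrightarrow> e \<noteq> e' \<Longrightarrow> eint e \<inter> path_image (c e') = {}"
  using drawing unfolding plane_drawing_def eint_def by simp_all

lemma path_image_c: "e \<in> edges G \<Longrightarrow> path_image (c e) = eint e \<union> p ` e"
proof -
  assume e: "e \<in> edges G"
  have "{0..1::real} = {0<..<1} \<union> {0, 1}" by auto
  then have "path_image (c e) = eint e \<union> {pathstart (c e), pathfinish (c e)}"
    unfolding path_image_def eint_def pathstart_def pathfinish_def by (simp add: image_Un)
  then show ?thesis using ends_c[OF e] by simp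
qed

lemma compact_curve: "e \<in> edges G \<Longrightarrow> compact (path_image (c e))"
  by (simp add: arc_c arc_imp_path compact_path_image)

lemma compact_curves: "E' \<subseteq> edges G \<Longrightarrow> compact (curves E')"
  unfolding curves_def using finite_edges finite_subset
  by (intro compact_UN) (auto intro: compact_curve)

lemma compact_draw: "E' \<subseteq> edges G \<Longrightarrow> compact (draw E')"
  unfolding draw_def by (intro compact_Un compact_curves finite_imp_compact finite_imageI finite_verts)

lemma open_compl_draw: "E' \<subseteq> edges G \<Longrightarrow> open (- draw E')"
  by (intro open_Compl compact_imp_closed compact_draw)

lemma draw_insert: "draw (insert e E') = draw E' \<union> path_image (c e)"
  unfolding draw_def curves_def by blast

lemma draw_Int_curve:
  assumes "E' \<subseteq> edges G" "e \<in> edges G" "e \<notin> E'"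
  shows "draw E' \<inter> path_image (c e) = p ` e"
proof -
  have "eint e \<inter> curves E' = {}"
    unfolding curves_def using inner_curve assms by blast
  moreover have "p ` e \<subseteq> p ` verts G"
    using edge_subset[OF assms(2)] by blast
  ultimately show ?thesis
    using inner_verts[OF assms(2)] unfolding draw_def path_image_c[OF assms(2)] by blast
qed

lemma inner_Int_draw:
  assumes "E' \<subseteq> edges G" "e \<in> edges G" "e \<notin> E'"
  shows "eint e \<inter> draw E' = {}"
proof -
  have "eint e \<inter> curves E' = {}"
    unfolding curves_def using inner_curve assms by blast
  then show ?thesis
    using inner_verts[OF assms(2)] unfolding draw_def by blast
qed

lemma continuous_c: "e \<in> edges G \<Longrightarrow> continuous_on {0..1} (c e)"
  using arc_c arc_imp_path unfolding path_def by blast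

lemma connected_inner: "e \<in> edges G \<Longrightarrow> connected (eint e)"
  unfolding eint_def
  by (intro connected_continuous_image continuous_on_subset[OF continuous_c]) auto

lemma inner_nonempty: "eint e \<noteq> {}"
  unfolding eint_def by (auto intro: exI[of _ "1/2"])

lemma curve_subset_closure_inner:
  assumes "e \<in> edges G"
  shows "path_image (c e) \<subseteq> closure (eint e)"
proof -
  have "continuous_on (closure {0<..<1}) (c e)"
    using continuous_c[OF assms] by simp
  then have "c e ` closure {0<..<1} \<subseteq> closure (eint e)"
    unfolding eint_def by (rule image_closure_subset[OF _ closed_closure closure_subset])
  then show ?thesis by (simp add: path_image_def)
qed

lemma oriented_arc:
  assumes "{u, v} \<in> edges G"
  obtains g where "arc g" "pathstart g = p u" "pathfinish g = p v" "path_image g = path_image (c {u, v})"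
proof -
  consider "pathstart (c {u, v}) = p u" "pathfinish (c {u, v}) = p v"
    | "pathstart (c {u, v}) = p v" "pathfinish (c {u, v}) = p u"
    using ends_c[OF assms] by (auto simp: doubleton_eq_iff)
  then show thesis
  proof cases
    case 1
    then show thesis using that arc_c[OF assms] by blast
  next
    case 2
    then show thesis
      using that[of "reversepath (c {u, v})"] arc_c[OF assms] by (simp add: arc_reversepath)
  qed
qed

lemma draw_Union:
  "draw E' = \<Union>((\<lambda>v. {p v}) ` verts G \<union> (\<lambda>e. path_image (c e)) ` E')"
  unfolding draw_def curves_def by blast

lemma edge_sides:
  assumes e: "e \<in> edges G" and x: "x \<in> eint e"
  obtains D P Q where "open D" "x \<in> D" "D - path_image (c e) = P \<union> Q"
    "D \<inter> draw (edges G - {e}) = {}"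
    "\<forall>p\<in>P. \<forall>q\<in>P. connected_component (- draw (edges G)) p q"
    "\<forall>p\<in>Q. \<forall>q\<in>Q. connected_component (- draw (edges G)) p q"
    "D \<inter> path_image (c e) \<subseteq> closure P" "D \<inter> path_image (c e) \<subseteq> closure Q"
proof -
  define E' where "E' = edges G - {e}"
  have E': "E' \<subseteq> edges G" "e \<notin> E'" unfolding E'_def by auto
  let ?F = "(\<lambda>v. {p v}) ` verts G \<union> (\<lambda>e. path_image (c e)) ` E'"
  have 1: "finite ?F"
    using finite_verts finite_edges finite_subset E' by blast
  have 2: "compact M \<and> path_connected M" if "M \<in> ?F" for M
    using that E' by (auto simp: compact_curve arc_c arc_imp_path path_connected_path_image subset_iff)
  have 3: "draw E' \<inter> path_image (c e) = {pathstart (c e), pathfinish (c e)}"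
    using draw_Int_curve[OF E'(1) e E'(2)] ends_c[OF e] by simp
  have 4: "x \<in> path_image (c e) - draw E'"
    using e x inner_Int_draw[OF E'(1) e E'(2)] path_image_c by blast
  have D: "draw E' \<union> path_image (c e) = draw (edges G)"
    using draw_insert[of e E'] e unfolding E'_def by (simp add: insert_absorb)
  show thesis
  proof (rule arc_sides[OF arc_c[OF e] 1 2 draw_Union 3 4], unfold D)
    fix D P Q
    assume *: "open D" "x \<in> D" "D - path_image (c e) = P \<union> Q" "D \<inter> draw E' = {}"
      "\<And>p q. p \<in> P \<Longrightarrow> q \<in> P \<Longrightarrow> connected_component (- draw (edges G)) p q"
      "\<And>p q. p \<in> Q \<Longrightarrow> q \<in> Q \<Longrightarrow> connected_component (- draw (edges G)) p q"
      "D \<inter> path_image (c e) \<subseteq> closure P" "D \<inter> path_image (c e) \<subseteq> closure Q"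
    show thesis
      by (rule that[folded E'_def, OF *(1-4) _ _ *(7,8)]) (use *(5,6) in blast)+
  qed
qed

lemma face_facts:
  assumes "F \<in> faces"
  shows "open F" "connected F" "F \<noteq> {}" "F \<inter> draw (edges G) = {}" "frontier F \<subseteq> draw (edges G)"
proof -
  show "open F" using assms open_components open_compl_draw by blast
  show "connected F" using assms in_components_connected by blast
  show "F \<noteq> {}" using assms in_components_nonempty by blast
  show "F \<inter> draw (edges G) = {}" using assms in_components_subset by blast
  have "frontier F \<subseteq> frontier (- draw (edges G))"
    using assms by (rule frontier_of_components_subset)
  also have "\<dots> \<subseteq> draw (edges G)"
    using compact_imp_closed[OF compact_draw] by (simp add: frontier_subset_closed)
  finally show "frontier F \<subseteq> draw (edges G)" .
qed

lemma inner_in_draw: "e \<in> edges G \<Longrightarrow> eint e \<subseteq> draw (edges G)"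
  using path_image_c unfolding draw_def curves_def by blast

text \<open>The part of an edge interior in the closure of \<open>F\<close> is closed, and also
  open: near each of its points \<open>F\<close> contains a full side of the edge, and either side
  is dense at the edge. By connectedness an edge borders a face entirely or not at all.\<close>

lemma bdI:
  assumes F: "F \<in> faces" and e: "e \<in> edges G" and ne: "eint e \<inter> closure F \<noteq> {}"
  shows "e \<in> bd F"
proof -
  define S where "S = eint e \<inter> closure F"
  have "openin (top_of_set (eint e)) S"
  proof (subst openin_subopen, intro ballI)
    fix x assume x: "x \<in> S"
    then have "x \<in> eint e" unfolding S_def by blast
    obtain D P Q where D: "open D" "x \<in> D"
      and PQ: "D - path_image (c e) = P \<union> Q" "D \<inter> draw (edges G - {e}) = {}"
      and P: "\<forall>p\<in>P. \<forall>q\<in>P. connected_component (- draw (edges G)) p q"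
      and Q: "\<forall>p\<in>Q. \<forall>q\<in>Q. connected_component (- draw (edges G)) p q"
      and cl: "D \<inter> path_image (c e) \<subseteq> closure P" "D \<inter> path_image (c e) \<subseteq> closure Q"
      by (rule edge_sides[OF e \<open>x \<in> eint e\<close>])
    have "D \<inter> F \<noteq> {}"
      using D x open_Int_closure_eq_empty[of D F] unfolding S_def by blast
    then obtain z where z: "z \<in> D" "z \<in> F" by blast
    have "z \<notin> path_image (c e)"
      using z face_facts(4)[OF F] e unfolding draw_def curves_def by blast
    then have "z \<in> P \<or> z \<in> Q" using PQ z by blast
    then have "P \<subseteq> F \<or> Q \<subseteq> F"
      using component_absorb[OF F z(2)] P Q by blast
    then have "D \<inter> path_image (c e) \<subseteq> closure F"
      using cl closure_mono[of P F] closure_mono[of Q F] by blast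
    then have "eint e \<inter> D \<subseteq> S"
      using path_image_c[OF e] unfolding S_def by blast
    moreover have "openin (top_of_set (eint e)) (eint e \<inter> D)"
      using D by (simp add: openin_open_Int)
    ultimately show "\<exists>T. openin (top_of_set (eint e)) T \<and> x \<in> T \<and> T \<subseteq> S"
      using D x unfolding S_def by blast
  qed
  moreover have "closedin (top_of_set (eint e)) S"
    unfolding S_def by (simp add: closedin_closed_Int)
  ultimately have "S = eint e"
    using connected_inner[OF e] ne unfolding connected_clopen S_def by blast
  then show ?thesis
    using e unfolding bd_def S_def by blast
qed

text \<open>A face that borders the edge meets one of its two local sides, and each side lies within
  a single face.\<close>

lemma card_faces_at_edge:
  assumes S: "S \<subseteq> faces" and e: "e \<in> edges G"
  shows "card {F \<in> S. e \<in> bd F} \<le> 2"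
proof -
  obtain x where x: "x \<in> eint e" using inner_nonempty by blast
  obtain D P Q where D: "open D" "x \<in> D"
      and PQ: "D - path_image (c e) = P \<union> Q" "D \<inter> draw (edges G - {e}) = {}"
      and P: "\<forall>p\<in>P. \<forall>q\<in>P. connected_component (- draw (edges G)) p q"
      and Q: "\<forall>p\<in>Q. \<forall>q\<in>Q. connected_component (- draw (edges G)) p q"
      and cl: "D \<inter> path_image (c e) \<subseteq> closure P" "D \<inter> path_image (c e) \<subseteq> closure Q"
    by (rule edge_sides[OF e x])
  define f where "f T = {F \<in> faces. T \<inter> F \<noteq> {}}" for T :: "complex set"
  have f: "finite (f T) \<and> card (f T) \<le> 1"
    if T: "\<forall>p\<in>T. \<forall>q\<in>T. connected_component (- draw (edges G)) p q" for T
  proof -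
    have "F = F'" if "F \<in> f T" "F' \<in> f T" for F F'
      using that T component_eqI[of F "- draw (edges G)" F'] unfolding f_def by blast
    then show ?thesis
      by (metis card_le_Suc0_iff_eq One_nat_def finite.simps infinite_imp_nonempty is_singletonI' is_singleton_def)
  qed
  have "{F \<in> S. e \<in> bd F} \<subseteq> f P \<union> f Q"
  proof
    fix F assume F: "F \<in> {F \<in> S. e \<in> bd F}"
    then have "F \<in> faces" using S by blast
    have "x \<in> closure F" using F x unfolding bd_def by blast
    then obtain z where z: "z \<in> D" "z \<in> F"
      using D open_Int_closure_eq_empty[of D F] by blast
    then have "z \<notin> path_image (c e)"
      using face_facts(4)[OF \<open>F \<in> faces\<close>] e unfolding draw_def curves_def by blast
    with PQ z \<open>F \<in> faces\<close> show "F \<in> f P \<union> f Q"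
      unfolding f_def by blast
  qed
  then have "card {F \<in> S. e \<in> bd F} \<le> card (f P \<union> f Q)"
    using f P Q by (intro card_mono) auto
  also have "\<dots> \<le> card (f P) + card (f Q)" by (rule card_Un_le)
  also have "\<dots> \<le> 2" using f[of P] f[of Q] P Q by fastforce
  finally show ?thesis .
qed

text \<open>A small disc around \<open>p v\<close> meets the drawing only in \<open>p v\<close> and
  in edges at \<open>v\<close>. The punctured disc is connected, meets \<open>F\<close>, and is not
  contained in \<open>F\<close> because \<open>e0\<close> enters it; so it contains a frontier point
  of \<open>F\<close>, which lies inside an edge at \<open>v\<close>.\<close>

lemma vertex_in_bd:
  assumes F: "F \<in> faces" and v: "v \<in> verts G" "p v \<in> closure F" and e0: "e0 \<in> edges G" "v \<in> e0"
  shows "\<exists>e\<in>bd F. v \<in> e"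
proof (rule ccontr)
  assume no: "\<not> ?thesis"
  define R where "R = p ` (verts G - {v}) \<union> curves {e \<in> edges G. v \<notin> e}"
  have "compact R"
    unfolding R_def by (intro compact_Un compact_curves finite_imp_compact) (auto simp: finite_verts)
  moreover have "p v \<notin> R"
  proof
    assume "p v \<in> R"
    moreover have "p v \<notin> p ` (verts G - {v})"
      using inj_p v by (auto dest: inj_onD)
    ultimately obtain e where e: "e \<in> edges G" "v \<notin> e" "p v \<in> path_image (c e)"
      unfolding R_def curves_def by blast
    then have "p v \<in> p ` e"
      using inner_verts[OF e(1)] v path_image_c[OF e(1)] by blast
    then show False
      using inj_p v e edge_subset[OF e(1)] by (meson inj_on_image_mem_iff)
  qed
  ultimately obtain r where r: "r > 0" "ball (p v) r \<subseteq> - R"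
    by (meson ComplI compact_imp_closed openE open_Compl)
  define D where "D = ball (p v) r"
  have D: "open D" "connected D" "p v \<in> D" "D \<inter> R = {}" using r unfolding D_def by auto
  have DX: "D \<inter> draw (edges G) \<subseteq> insert (p v) (\<Union>e\<in>{e \<in> edges G. v \<in> e}. eint e)"
  proof
    fix z assume z: "z \<in> D \<inter> draw (edges G)"
    then have "z \<notin> R" using D by blast
    from z consider "z \<in> p ` verts G" | e where "e \<in> edges G" "z \<in> path_image (c e)"
      unfolding draw_def curves_def by blast
    then show "z \<in> insert (p v) (\<Union>e\<in>{e \<in> edges G. v \<in> e}. eint e)"
    proof cases
      case 1
      with \<open>z \<notin> R\<close> show ?thesis unfolding R_def by blast
    next
      case 2
      with \<open>z \<notin> R\<close> have "v \<in> e" unfolding R_def curves_def by blast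
      moreover have "z \<in> eint e \<or> z \<in> p ` verts G"
        using 2 path_image_c edge_subset by blast
      ultimately show ?thesis using 2 \<open>z \<notin> R\<close> unfolding R_def by blast
    qed
  qed
  have conn: "connected (D - {p v})"
    using D by (intro connected_open_delete) auto
  have "F \<inter> D \<noteq> {}"
    using D v open_Int_closure_eq_empty[of D F] by blast
  moreover have "p v \<notin> F"
    using face_facts(4)[OF F] v unfolding draw_def by blast
  ultimately have 1: "(D - {p v}) \<inter> F \<noteq> {}" by blast
  have "p v \<in> closure (eint e0)"
    using curve_subset_closure_inner[OF e0(1)] path_image_c[OF e0(1)] e0(2) by blast
  then obtain y where y: "y \<in> D" "y \<in> eint e0"
    using D open_Int_closure_eq_empty[of D "eint e0"] by blast
  then have "y \<noteq> p v" "y \<notin> F"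
    using inner_verts[OF e0(1)] v face_facts(4)[OF F] inner_in_draw[OF e0(1)] by blast+
  with y have 2: "(D - {p v}) - F \<noteq> {}" by blast
  obtain z where z: "z \<in> D" "z \<noteq> p v" "z \<in> frontier F"
    using connected_Int_frontier[OF conn 1 2] by blast
  then obtain e where "e \<in> edges G" "v \<in> e" "z \<in> eint e"
    using face_facts(5)[OF F] DX by blast
  moreover have "z \<in> closure F" using z unfolding frontier_def by blast
  ultimately have "e \<in> bd F" using bdI[OF F] by blast
  with no \<open>v \<in> e\<close> show False by blast
qed

lemma bd_subset: "bd F \<subseteq> edges G"
  unfolding bd_def by blast

text \<open>The bordering edges alone already cut out the face, so separation properties of this
  edge set apply to it. Without \<open>deg\<close> an isolated vertex could be a frontier point that
  lies on no edge.\<close>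

lemma face_component_bd:
  assumes F: "F \<in> faces" and deg: "\<And>v. v \<in> verts G \<Longrightarrow> \<exists>e\<in>edges G. v \<in> e"
  shows "frontier F \<subseteq> curves (bd F)" "F \<in> components (- curves (bd F))"
proof -
  show fr: "frontier F \<subseteq> curves (bd F)"
  proof
    fix z assume z: "z \<in> frontier F"
    then have zc: "z \<in> closure F" unfolding frontier_def by blast
    have "z \<in> draw (edges G)" using z face_facts(5)[OF F] by blast
    then consider v where "v \<in> verts G" "z = p v" | e where "e \<in> edges G" "z \<in> path_image (c e)"
      unfolding draw_def curves_def by blast
    then have "(\<exists>v\<in>verts G. z = p v) \<or> (\<exists>e\<in>edges G. z \<in> eint e)"
    proof cases
      case 2
      then show ?thesis using path_image_c[OF 2(1)] edge_subset[OF 2(1)] by blast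
    qed blast
    then show "z \<in> curves (bd F)"
    proof (elim disjE bexE)
      fix v assume v: "v \<in> verts G" "z = p v"
      with vertex_in_bd[OF F v(1)] deg[OF v(1)] zc obtain e where e: "e \<in> bd F" "v \<in> e" by blast
      with v path_image_c[of e] bd_subset show ?thesis unfolding curves_def by blast
    next
      fix e assume e: "e \<in> edges G" "z \<in> eint e"
      with bdI[OF F e(1)] zc have "e \<in> bd F" by blast
      with e path_image_c[of e] show ?thesis unfolding curves_def by blast
    qed
  qed
  have "curves (bd F) \<subseteq> draw (edges G)"
    using bd_subset unfolding draw_def curves_def by blast
  then show "F \<in> components (- curves (bd F))"
    using face_facts[OF F] fr by (intro components_complementI) blast+
qed

end

subsection \<open>Euler's inequality\<close>

context plane_graph
begin

lemma component_refines:
  assumes U: "U \<in> components (- X)" and z: "z \<in> U" "z \<notin> X'" and sub: "X \<subseteq> X'"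
  shows "connected_component_set (- X') z \<in> components (- X')" "connected_component_set (- X') z \<subseteq> U"
proof -
  show "connected_component_set (- X') z \<in> components (- X')"
    using z unfolding components_iff by blast
  show "connected_component_set (- X') z \<subseteq> U"
  proof
    fix y assume "y \<in> connected_component_set (- X') z"
    then have "connected_component (- X) z y"
      using sub connected_component_of_subset[of "- X'" z y "- X"] by blast
    then show "y \<in> U" using component_absorb[OF U z(1)] by blast
  qed
qed

text \<open>An open set is not covered by an arc, so adding an edge never swallows a face.\<close>

lemma face_survives:
  assumes E': "E' \<subseteq> edges G" and e: "e \<in> edges G" and U: "U \<in> components (- draw E')"
  shows "\<exists>W \<in> components (- draw (insert e E')). W \<subseteq> U"
proof -
  have "open U" "U \<noteq> {}" "U \<inter> draw E' = {}"
    using U open_components open_compl_draw[OF E'] in_components_nonempty in_components_subset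
    by blast+
  then have "\<not> U \<subseteq> path_image (c e)"
    using interior_path_image_arc[OF arc_c[OF e]] interior_maximal[of U "path_image (c e)"] by blast
  then obtain z where z: "z \<in> U" "z \<notin> draw (insert e E')"
    using \<open>U \<inter> draw E' = {}\<close> unfolding draw_insert by blast
  show ?thesis
    using component_refines[OF U z] unfolding draw_insert by blast
qed

text \<open>The new edge and an arc in the old drawing form a Jordan curve. A disc around an inner
  point of the edge lies in one old face and meets both sides of the curve.\<close>

lemma face_splits:
  assumes E': "E' \<subseteq> edges G" and e: "{a, b} \<in> edges G" "{a, b} \<notin> E'"
    and pc: "path_component (draw E') (p a) (p b)"
  shows "\<exists>U \<in> components (- draw E'). \<exists>W1 \<in> components (- draw (insert {a, b} E')).
    \<exists>W2 \<in> components (- draw (insert {a, b} E')). W1 \<noteq> W2 \<and> W1 \<subseteq> U \<and> W2 \<subseteq> U"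
proof -
  define e where "e = {a, b}"
  obtain \<gamma> where \<gamma>: "arc \<gamma>" "pathstart \<gamma> = p a" "pathfinish \<gamma> = p b" "path_image \<gamma> = path_image (c e)"
    unfolding e_def by (rule oriented_arc[OF e(1)])
  have "p b \<noteq> p a" using arc_distinct_ends[OF \<gamma>(1)] \<gamma> by simp
  then obtain \<beta> where \<beta>: "arc \<beta>" "path_image \<beta> \<subseteq> draw E'" "pathstart \<beta> = p b" "pathfinish \<beta> = p a"
    using path_component_arc[OF path_component_sym[OF pc]] by metis
  have int: "draw E' \<inter> path_image \<gamma> = {pathstart \<gamma>, pathfinish \<gamma>}"
    using draw_Int_curve[OF E' e] \<gamma> unfolding e_def by simp
  interpret arc_chord \<gamma> \<beta> "draw E'"
    using \<gamma> \<beta> int compact_draw[OF E'] by unfold_locales simp_all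
  obtain x where x: "x \<in> eint e" using inner_nonempty by blast
  then have xd: "x \<notin> draw E'" and xg: "x \<in> path_image \<gamma>"
    using inner_Int_draw[OF E' e] path_image_c[OF e(1)] \<gamma>(4) unfolding e_def by blast+
  obtain r where r: "r > 0" "ball x r \<subseteq> - draw E'"
    using xd open_compl_draw[OF E'] by (meson ComplI openE)
  define D where "D = ball x r"
  have D: "open D" "connected D" "x \<in> D" "D \<inter> draw E' = {}" using r unfolding D_def by auto
  have "D \<inter> inside C \<noteq> {}" "D \<inter> outside C \<noteq> {}"
    using sides_dense[OF D(1)] D(3) xg by fastforce+
  then obtain y z where yz: "y \<in> D" "y \<in> inside C" "z \<in> D" "z \<in> outside C" by blast
  define X' where "X' = draw (insert e E')"
  have X': "X' = draw E' \<union> path_image \<gamma>" unfolding X'_def draw_insert \<gamma>(4) ..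
  have nX': "y \<notin> X'" "z \<notin> X'"
    using sides_cover[OF D(4)] yz D(4) unfolding X' by blast+
  define U where "U = connected_component_set (- draw E') x"
  have U: "U \<in> components (- draw E')" unfolding U_def components_iff using xd by blast
  have "D \<subseteq> U"
    unfolding U_def using D by (intro connected_component_maximal) auto
  then have "y \<in> U" "z \<in> U" using yz by blast+
  have "draw E' \<subseteq> X'" unfolding X' by blast
  note W = component_refines[OF U \<open>y \<in> U\<close> nX'(1) this] component_refines[OF U \<open>z \<in> U\<close> nX'(2) this]
  have ne: "connected_component_set (- X') y \<noteq> connected_component_set (- X') z"
  proof
    assume "connected_component_set (- X') y = connected_component_set (- X') z"
    then have "connected_component (- X') y z"
      using nX' by (metis ComplI connected_component_refl mem_Collect_eq)
    then show False using separated[OF yz(2,4)] unfolding X' by blast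
  qed
  show ?thesis
    unfolding e_def[symmetric] X'_def[symmetric]
    by (intro bexI[OF _ U] bexI[OF _ W(1)] bexI[OF _ W(3)] conjI ne W(2) W(4))
qed

lemma disjoint_refinement_inj:
  assumes "\<And>U. U \<in> \<U> \<Longrightarrow> W U \<subseteq> U \<and> W U \<noteq> {}" "\<And>U U'. U \<in> \<U> \<Longrightarrow> U' \<in> \<U> \<Longrightarrow> U \<noteq> U' \<Longrightarrow> U \<inter> U' = {}"
  shows "inj_on W \<U>"
proof (rule inj_onI)
  fix U U' assume "U \<in> \<U>" "U' \<in> \<U>" "W U = W U'"
  with assms(1)[of U] assms(1)[of U'] have "U \<inter> U' \<noteq> {}" by blast
  with assms(2)[of U U'] \<open>U \<in> \<U>\<close> \<open>U' \<in> \<U>\<close> show "U = U'" by blast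
qed

text \<open>Vertices with the same label are connected by the edges drawn so far. An edge that joins two
  labels merges them, an edge between equally labelled vertices splits a face.\<close>

lemma euler_labelled:
  assumes "E' \<subseteq> edges G"
  shows "\<exists>S (l :: 'a \<Rightarrow> 'a). finite S \<and> S \<subseteq> components (- draw E') \<and>
    card E' + 1 + card (l ` verts G) \<le> card S + card (verts G) \<and>
    (\<forall>u\<in>verts G. \<forall>v\<in>verts G. l u = l v \<longrightarrow> path_component (draw E') (p u) (p v))"
  using finite_subset[OF assms finite_edges] assms
proof (induction E' rule: finite_induct)
  case empty
  have d: "draw {} = p ` verts G" unfolding draw_def curves_def by simp
  have "connected (- draw {})"
    unfolding d by (intro path_connected_imp_connected path_connected_complement_countable)
      (auto simp: finite_verts countable_finite)
  moreover have "- draw {} \<noteq> {}"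
    unfolding d using finite_verts infinite_UNIV_char_0[where 'a = complex]
    by (metis Compl_empty_eq double_complement finite_imageI)
  ultimately have "components (- draw {}) = {- draw {}}"
    by (simp add: components_eq_sing_iff)
  moreover have "path_component (draw {}) (p u) (p v)" if "u \<in> verts G" "u = v" for u v
    using that unfolding d by (auto intro: path_component_refl)
  ultimately show ?case
    by (intro exI[of _ "{- draw {}}"] exI[of _ "\<lambda>v. v"]) auto
next
  case (insert e E')
  have E': "E' \<subseteq> edges G" and e: "e \<in> edges G" using insert.prems by auto
  from insert.IH[OF E'] obtain S and l :: "'a \<Rightarrow> 'a" where S: "finite S" "S \<subseteq> components (- draw E')"
    and ineq: "card E' + 1 + card (l ` verts G) \<le> card S + card (verts G)"
    and pc: "\<And>u v. u \<in> verts G \<Longrightarrow> v \<in> verts G \<Longrightarrow> l u = l v \<Longrightarrow> path_component (draw E') (p u) (p v)"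
    by blast
  let ?X' = "draw (insert e E')"
  have sub: "draw E' \<subseteq> ?X'" unfolding draw_insert by blast
  have pc': "path_component ?X' (p u) (p v)" if "u \<in> verts G" "v \<in> verts G" "l u = l v" for u v
    using pc[OF that] path_component_of_subset[OF sub] by blast
  obtain W where W: "\<And>U. U \<in> S \<Longrightarrow> W U \<in> components (- ?X') \<and> W U \<subseteq> U"
    using face_survives[OF E' e] S(2) by (metis subsetD)
  have disj: "U \<inter> U' = {}" if "U \<in> components (- draw E')" "U' \<in> components (- draw E')" "U \<noteq> U'" for U U'
    using that components_nonoverlap by blast
  have Wne: "W U \<noteq> {}" if "U \<in> S" for U using W[OF that] in_components_nonempty by blast
  have injW: "inj_on W T" if "T \<subseteq> S" for T
  proof (rule disjoint_refinement_inj)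
    show "W U \<subseteq> U \<and> W U \<noteq> {}" if "U \<in> T" for U
      using that \<open>T \<subseteq> S\<close> W[of U] Wne[of U] by blast
    show "U \<inter> U' = {}" if "U \<in> T" "U' \<in> T" "U \<noteq> U'" for U U'
      using disj[of U U'] that \<open>T \<subseteq> S\<close> S(2) by blast
  qed
  obtain a b where ab: "e = {a, b}" "a \<noteq> b" "a \<in> verts G" "b \<in> verts G" using edgeE[OF e] .
  show ?case
  proof (cases "l a = l b")
    case True
    obtain U0 W1 W2 where U0: "U0 \<in> components (- draw E')" and W12: "W1 \<in> components (- ?X')"
      "W2 \<in> components (- ?X')" "W1 \<noteq> W2" "W1 \<subseteq> U0" "W2 \<subseteq> U0"
      using face_splits[OF E', of a b] e insert.hyps pc[OF ab(3,4) True] unfolding ab(1) by blast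
    \<comment> \<open>\<open>U0\<close> may or may not belong to \<open>S\<close>. Discarding its
      descendant, if there is one, and adding both halves gains at least one face in either
      case.\<close>
    define S' where "S' = W ` (S - {U0}) \<union> {W1, W2}"
    have "W ` (S - {U0}) \<inter> {W1, W2} = {}"
    proof -
      have "W U \<inter> U0 = {}" if "U \<in> S - {U0}" for U
        using that W[of U] disj[of U U0] S(2) U0 by blast
      moreover have "W1 \<noteq> {}" "W2 \<noteq> {}" using W12 in_components_nonempty by blast+
      ultimately show ?thesis using W12 by blast
    qed
    then have "card S' = card (S - {U0}) + 2"
      unfolding S'_def using S(1) W12(3) card_image[OF injW[of "S - {U0}"]]
      by (subst card_Un_disjoint) auto
    moreover have "card S \<le> card (S - {U0}) + 1"
      using S(1) by (cases "U0 \<in> S") (simp_all add: card_Diff_singleton)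
    moreover have "card (insert e E') = card E' + 1" using insert.hyps by simp
    ultimately have "card (insert e E') + 1 + card (l ` verts G) \<le> card S' + card (verts G)"
      using ineq by linarith
    moreover have "finite S'" "S' \<subseteq> components (- ?X')"
      unfolding S'_def using S(1) W W12 by blast+
    ultimately show ?thesis using pc' by blast
  next
    case False
    define l' where "l' v = (if l v = l b then l a else l v)" for v
    have "l ` verts G = insert (l b) (l' ` verts G)"
      using ab False unfolding l'_def by (auto simp: image_iff)
    moreover have "l b \<notin> l' ` verts G" using False unfolding l'_def by auto
    ultimately have "card (l ` verts G) = card (l' ` verts G) + 1"
      using finite_verts by simp
    moreover have "card (W ` S) = card S" by (rule card_image[OF injW]) simp
    moreover have "card (insert e E') = card E' + 1" using insert.hyps by simp
    ultimately have "card (insert e E') + 1 + card (l' ` verts G) \<le> card (W ` S) + card (verts G)"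
      using ineq by linarith
    moreover have "path_component ?X' (p u) (p v)"
      if uv: "u \<in> verts G" "v \<in> verts G" "l' u = l' v" for u v
    proof -
      obtain \<gamma> where \<gamma>: "arc \<gamma>" "pathstart \<gamma> = p a" "pathfinish \<gamma> = p b" "path_image \<gamma> = path_image (c e)"
        using oriented_arc e unfolding ab(1) by blast
      have "path_component ?X' (p a) (p b)"
        unfolding path_component_def draw_insert using \<gamma> arc_imp_path by blast
      then have ab': "path_component ?X' (p w) (p a)" if "w \<in> verts G" "l w = l b \<or> l w = l a" for w
        using that pc'[of w a] pc'[of w b] ab path_component_sym path_component_trans by meson
      show ?thesis
      proof (cases "l u = l v")
        case False
        then have "l u = l b \<or> l u = l a" "l v = l b \<or> l v = l a"
          using uv(3) unfolding l'_def by (auto split: if_splits)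
        then show ?thesis using ab' uv path_component_sym path_component_trans by meson
      qed (use pc' uv in blast)
    qed
    moreover have "finite (W ` S)" "W ` S \<subseteq> components (- ?X')" using S(1) W by blast+
    ultimately show ?thesis by blast
  qed
qed

text \<open>At least one label remains. A finite family \<open>S\<close> is enough, since only a
  lower bound on the number of faces is wanted and the later counts run over
  \<open>S\<close>.\<close>

lemma euler_inequality:
  assumes "verts G \<noteq> {}"
  obtains S where "finite S" "S \<subseteq> faces" "card (edges G) + 2 \<le> card S + card (verts G)"
proof -
  obtain S and l :: "'a \<Rightarrow> 'a" where "finite S" "S \<subseteq> faces"
    "card (edges G) + 1 + card (l ` verts G) \<le> card S + card (verts G)"
    using euler_labelled[of "edges G"] by blast
  moreover have "card (l ` verts G) \<ge> 1"
    using assms finite_verts by (simp add: Suc_le_eq card_gt_0_iff)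
  ultimately show thesis using that by fastforce
qed

end

subsection \<open>Faces bounded by 4-cycles\<close>

lemma no_triangleD:
  assumes "subgraph_free (cycle_graph 3) G" "simple_graph G"
    "{x, y} \<in> edges G" "{y, z} \<in> edges G" "{x, z} \<in> edges G"
  shows False
proof -
  have ne: "u \<noteq> v \<and> u \<in> verts G \<and> v \<in> verts G" if "{u, v} \<in> edges G" for u v
    using that assms(2) unfolding simple_graph_def by (cases "u = v") auto
  define f where "f i = [x, y, z] ! i" for i
  have lt: "{..<3} = {0, 1, 2::nat}" by auto
  have "inj_on f {..<3}"
    unfolding lt f_def using ne[OF assms(3)] ne[OF assms(4)] ne[OF assms(5)] by (auto simp: inj_on_def)
  moreover have "f ` {..<3} \<subseteq> verts G"
    unfolding lt f_def using ne[OF assms(3)] ne[OF assms(4)] by auto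
  moreover have "f ` e \<in> edges G" if "e \<in> edges (cycle_graph 3)" for e
  proof -
    obtain i where "i \<in> {..<3}" "e = {i, (i + 1) mod 3}"
      using \<open>e \<in> edges (cycle_graph 3)\<close> unfolding cycle_graph_def by auto
    then show ?thesis
      unfolding lt f_def using assms(3-5) by (auto simp: insert_commute)
  qed
  moreover have "verts (cycle_graph 3) = {..<3}" by (simp add: cycle_graph_def)
  ultimately have "contains_subgraph G (cycle_graph 3)" unfolding contains_subgraph_def by metis
  then show False using assms(1) by (simp add: subgraph_free_def)
qed

lemma no_hexagonD:
  assumes "subgraph_free (cycle_graph 6) G" "simple_graph G" "distinct [u, v, w, x, y, z]"
    "{u, v} \<in> edges G" "{v, w} \<in> edges G" "{w, x} \<in> edges G" "{x, y} \<in> edges G" "{y, z} \<in> edges G" "{z, u} \<in> edges G"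
  shows False
proof -
  have mem: "u \<in> verts G \<and> v \<in> verts G" if "{u, v} \<in> edges G" for u v
    using that assms(2) unfolding simple_graph_def by auto
  define f where "f i = [u, v, w, x, y, z] ! i" for i
  have lt: "{..<6} = {0, 1, 2, 3, 4, 5::nat}" by auto
  have "inj_on f {..<6}"
    using inj_on_nth[OF assms(3), of "{..<6}"] unfolding f_def by simp
  moreover have "f ` {..<6} \<subseteq> verts G"
    unfolding lt f_def using mem[OF assms(4)] mem[OF assms(6)] mem[OF assms(8)] by auto
  moreover have "f ` e \<in> edges G" if "e \<in> edges (cycle_graph 6)" for e
  proof -
    obtain i where "i \<in> {..<6}" "e = {i, (i + 1) mod 6}"
      using \<open>e \<in> edges (cycle_graph 6)\<close> unfolding cycle_graph_def by auto
    then show ?thesis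
      unfolding lt f_def using assms(4-9) by auto
  qed
  moreover have "verts (cycle_graph 6) = {..<6}" by (simp add: cycle_graph_def)
  ultimately have "contains_subgraph G (cycle_graph 6)" unfolding contains_subgraph_def by metis
  then show False using assms(1) by (simp add: subgraph_free_def)
qed

text \<open>Edge sets in which no vertex is a leaf stand in for cycles.\<close>

definition leafless :: "'a set set \<Rightarrow> bool" where
  "leafless B \<longleftrightarrow> B \<noteq> {} \<and> (\<forall>e\<in>B. \<forall>v\<in>e. \<exists>e'\<in>B. e' \<noteq> e \<and> v \<in> e')"

definition square :: "'a set set \<Rightarrow> 'a \<Rightarrow> 'a \<Rightarrow> 'a \<Rightarrow> 'a \<Rightarrow> bool" where
  "square B u v w x \<longleftrightarrow> distinct [u, v, w, x] \<and> B = {{u, v}, {v, w}, {w, x}, {x, u}}"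

text \<open>An edge \<open>u v\<close> of \<open>K\<close> continues at both ends, to
  \<open>u'\<close> and \<open>v'\<close>, and beyond \<open>u'\<close> to \<open>w\<close>. Without
  triangles these four edges are distinct. If there are no others, the edge that continues beyond
  \<open>v'\<close> must be among them, which forces \<open>w = v'\<close>.\<close>

lemma leafless_triangle_free:
  assumes B: "finite B" "\<And>e. e \<in> B \<Longrightarrow> card e = 2" and K: "K \<subseteq> B" "leafless K"
    and tf: "\<And>x y z. {x, y} \<in> B \<Longrightarrow> {y, z} \<in> B \<Longrightarrow> {x, z} \<in> B \<Longrightarrow> False"
  shows "4 \<le> card B" "card B = 4 \<Longrightarrow> \<exists>u v w x. square B u v w x"
proof -
  have next_edge: "\<exists>z. {y, z} \<in> K \<and> z \<noteq> x \<and> z \<noteq> y" if xy: "{x, y} \<in> K" for x y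
  proof -
    obtain e where e: "e \<in> K" "e \<noteq> {x, y}" "y \<in> e"
      using K(2) xy unfolding leafless_def by blast
    then have "card e = 2" using B(2) K(1) by blast
    then obtain s t where "e = {s, t}" "s \<noteq> t" unfolding card_2_iff by blast
    with e show ?thesis by (cases "s = y") (auto simp: insert_commute)
  qed
  obtain e where "e \<in> K" using K unfolding leafless_def by blast
  then have "card e = 2" using B(2) K(1) by blast
  then obtain u v where "e = {u, v}" "u \<noteq> v" unfolding card_2_iff by blast
  with \<open>e \<in> K\<close> have uv: "{u, v} \<in> K" "u \<noteq> v" by auto
  obtain u' where u': "{u, u'} \<in> K" "u' \<noteq> v" "u' \<noteq> u"
    using next_edge[of v u] uv by (auto simp: insert_commute)
  obtain v' where v': "{v, v'} \<in> K" "v' \<noteq> u" "v' \<noteq> v"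
    using next_edge[of u v] uv by blast
  obtain w where w: "{u', w} \<in> K" "w \<noteq> u" "w \<noteq> u'"
    using next_edge[of u u'] u' by blast
  have "u' \<noteq> v'"
    using tf[of u v v'] uv u' v' K(1) by blast
  have "w \<noteq> v"
  proof
    assume "w = v"
    then have "{v, u'} \<in> B" using w K(1) by (auto simp: insert_commute)
    then show False using tf[of u v u'] uv u' K(1) by blast
  qed
  let ?T = "{{u, v}, {u, u'}, {v, v'}, {u', w}}"
  have T: "?T \<subseteq> K" using uv u' v' w by blast
  have cT: "card ?T = 4"
    using uv u' v' w \<open>u' \<noteq> v'\<close> \<open>w \<noteq> v\<close> by (simp add: doubleton_eq_iff)
  have "card ?T \<le> card B"
    using T K(1) B(1) by (intro card_mono) auto
  then show "4 \<le> card B" using cT by simp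
  assume "card B = 4"
  then have BT: "B = ?T"
    using T K(1) B(1) cT by (metis card_subset_eq order_trans)
  obtain x where x: "{v', x} \<in> K" "x \<noteq> v" "x \<noteq> v'"
    using next_edge[of v v'] v' by blast
  then have "{v', x} \<in> ?T" using BT K(1) by blast
  then have "w = v'"
    using x v' \<open>u' \<noteq> v'\<close> uv by (auto simp: doubleton_eq_iff)
  then have "square B u v v' u'"
    using uv u' v' w \<open>u' \<noteq> v'\<close> unfolding square_def BT by (auto simp: insert_commute)
  then show "\<exists>u v w x. square B u v w x" by blast
qed

text \<open>The eight symmetries of a 4-cycle allow any edge, in either direction, to be named
  first.\<close>

lemma square_rotate:
  assumes "square B a b c d" "{x, y} \<in> B"
  shows "\<exists>z w. square B x y z w"
proof -
  have *: "square B a b c d" "square B b a d c" "square B b c d a" "square B c b a d"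
    "square B c d a b" "square B d c b a" "square B d a b c" "square B a d c b"
    using assms(1) unfolding square_def by (auto simp: insert_commute)
  have "x = a \<and> y = b \<or> x = b \<and> y = a \<or> x = b \<and> y = c \<or> x = c \<and> y = b \<or>
    x = c \<and> y = d \<or> x = d \<and> y = c \<or> x = d \<and> y = a \<or> x = a \<and> y = d"
    using assms unfolding square_def by (auto simp: doubleton_eq_iff)
  with * show ?thesis by blast
qed

lemma square_reverse: "square B a b c d \<Longrightarrow> square B b a d c"
  unfolding square_def by (auto simp: insert_commute)

context plane_graph
begin

lemma curves_insert: "curves (insert e E') = path_image (c e) \<union> curves E'"
  unfolding curves_def by blast

lemma curve_Int:
  assumes "e \<in> edges G" "e' \<in> edges G" "e \<noteq> e'"
  shows "path_image (c e) \<inter> path_image (c e') = p ` (e \<inter> e')"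
proof -
  have "path_image (c e) \<inter> path_image (c e') = p ` e \<inter> p ` e'"
    using inner_curve[OF assms] inner_curve[OF assms(2,1) assms(3)[symmetric]]
    unfolding path_image_c[OF assms(1)] path_image_c[OF assms(2)] by blast
  also have "\<dots> = p ` (e \<inter> e')"
    using inj_on_image_Int[OF inj_p edge_subset[OF assms(1)] edge_subset[OF assms(2)]] by simp
  finally show ?thesis .
qed

text \<open>Leaf edges are stripped one at a time. The curve of a leaf edge meets the other curves
  at most in its inner end \<open>p w\<close>, so by Janiszewski's theorem it does not disconnect
  the complement.\<close>

lemma forest_connected:
  assumes "E' \<subseteq> edges G" "\<And>K. K \<subseteq> E' \<Longrightarrow> \<not> leafless K"
  shows "connected (- curves E')"
  using finite_subset[OF assms(1) finite_edges] assms
proof (induction E' rule: finite_psubset_induct)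
  case (psubset E')
  show ?case
  proof (cases "E' = {}")
    case True
    then show ?thesis unfolding curves_def by (simp add: connected_UNIV)
  next
    case False
    have "\<not> leafless E'" using psubset.prems by blast
    then obtain e v where ev: "e \<in> E'" "v \<in> e" "\<And>e'. e' \<in> E' \<Longrightarrow> v \<in> e' \<Longrightarrow> e' = e"
      using False unfolding leafless_def by blast
    have e: "e \<in> edges G" using ev psubset.prems by blast
    obtain w where w: "e = {v, w}" using edgeE[OF e] ev(2) by (metis insert_commute insertE singletonD)
    define E0 where "E0 = E' - {e}"
    have E0: "E0 \<subset> E'" "E' = insert e E0" "E0 \<subseteq> edges G" using ev(1) psubset.prems(1) unfolding E0_def by auto
    have IH: "connected (- curves E0)"
      using psubset.IH[OF E0(1)] E0 psubset.prems(2) by blast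
    have "curves E0 \<inter> path_image (c e) \<subseteq> {p w}"
    proof
      fix z assume "z \<in> curves E0 \<inter> path_image (c e)"
      then obtain e' where e': "e' \<in> E0" "z \<in> path_image (c e') \<inter> path_image (c e)"
        unfolding curves_def by blast
      then have "z \<in> p ` (e' \<inter> e)"
        using curve_Int[of e' e] e E0 unfolding E0_def by blast
      moreover have "v \<notin> e'" using e'(1) ev(3) unfolding E0_def by blast
      ultimately show "z \<in> {p w}" using w by blast
    qed
    then have "connected (curves E0 \<inter> path_image (c e))"
      using subset_singletonD by fastforce
    then have "connected (- (curves E0 \<union> path_image (c e)))"
      using compact_curves[OF E0(3)] arc_c[OF e] IH
      by (intro Janiszewski_connected connected_arc_complement closed_path_image) (auto simp: arc_imp_path)
    then show ?thesis unfolding E0(2) curves_insert by (simp only: Un_commute)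
  qed
qed

end

section \<open>Counting in plane graphs of minimum degree three\<close>

locale dense_plane_graph = plane_graph +
  assumes nonempty: "verts G \<noteq> {}"
    and min_deg: "\<And>v. v \<in> verts G \<Longrightarrow> 3 \<le> degree G v"
    and triangle_free: "subgraph_free (cycle_graph 3) G"
    and hexagon_free: "subgraph_free (cycle_graph 6) G"
begin

lemma third_edge:
  assumes "v \<in> verts G"
  shows "\<exists>e\<in>edges G. v \<in> e \<and> e \<noteq> e1 \<and> e \<noteq> e2"
proof (rule ccontr)
  assume "\<not> ?thesis"
  then have "{e \<in> edges G. v \<in> e} \<subseteq> {e1, e2}" by blast
  then have "card {e \<in> edges G. v \<in> e} \<le> card {e1, e2}" by (intro card_mono) auto
  also have "\<dots> \<le> 2" by (simp add: card_insert_if)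
  finally show False using min_deg[OF assms] unfolding degree_def by simp
qed

text \<open>If the boundary were a forest, its complement would be connected and equal to
  \<open>F\<close>. An edge off the boundary would then run inside \<open>F\<close>, so all edges
  bound \<open>F\<close>. But the set of all edges is leafless by the degree condition.\<close>

lemma face_leafless:
  assumes F: "F \<in> faces"
  shows "\<exists>K\<subseteq>bd F. leafless K"
proof (rule ccontr)
  assume no: "\<not> ?thesis"
  have deg: "\<exists>e\<in>edges G. v \<in> e" if "v \<in> verts G" for v
    using third_edge[OF that] by blast
  have "connected (- curves (bd F))"
    using no by (intro forest_connected bd_subset) blast
  then have "F = - curves (bd F)"
    using face_component_bd(2)[OF F deg] by (metis components_eq_sing_iff components_empty empty_iff singletonD)
  then have all: "bd F = edges G"
  proof -
    have "e \<in> bd F" if e: "e \<in> edges G" for e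
    proof (rule ccontr)
      assume "e \<notin> bd F"
      then have "eint e \<inter> curves (bd F) = {}"
        using inner_Int_draw[OF bd_subset e] unfolding draw_def by blast
      then have "eint e \<subseteq> F" using \<open>F = - curves (bd F)\<close> by blast
      then show False
        using inner_nonempty inner_in_draw[OF e] face_facts(4)[OF F] by blast
    qed
    then show ?thesis using bd_subset by blast
  qed
  have "leafless (edges G)"
    unfolding leafless_def
  proof (intro conjI ballI)
    show "edges G \<noteq> {}" using nonempty deg by blast
    fix e v assume "e \<in> edges G" "v \<in> e"
    then show "\<exists>e'\<in>edges G. e' \<noteq> e \<and> v \<in> e'"
      using third_edge[of v e e] edge_subset by blast
  qed
  with no all show False by blast
qed

lemma bd_squares:
  assumes F: "F \<in> faces"
  shows "4 \<le> card (bd F)" "card (bd F) = 4 \<Longrightarrow> \<exists>a b c d. square (bd F) a b c d"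
proof -
  obtain K where K: "K \<subseteq> bd F" "leafless K" using face_leafless[OF F] by blast
  have fin: "finite (bd F)" using finite_subset[OF bd_subset finite_edges] .
  have two: "card e = 2" if "e \<in> bd F" for e
    using that bd_subset simple unfolding simple_graph_def by blast
  have tf: False if "{x, y} \<in> bd F" "{y, z} \<in> bd F" "{x, z} \<in> bd F" for x y z
    using that bd_subset[of F] no_triangleD[OF triangle_free simple] by blast
  show "4 \<le> card (bd F)" "card (bd F) = 4 \<Longrightarrow> \<exists>a b c d. square (bd F) a b c d"
    by (rule leafless_triangle_free[OF fin _ K]; use two tf in blast)+
qed

text \<open>Near \<open>b\<close> the path \<open>a b x\<close> has only two sides. They belong to \<open>F1\<close> and \<open>F2\<close>,
  so no third edge can leave \<open>b\<close>.\<close>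

lemma squares_share_no_path:
  assumes F: "F1 \<in> faces" "F2 \<in> faces" "F1 \<noteq> F2"
    and sq: "square (bd F1) a b x d" "square (bd F2) a b x d'"
  shows False
proof -
  have dist: "distinct [a, b, x, d]" "distinct [a, b, x, d']"
    and bd: "bd F1 = {{a, b}, {b, x}, {x, d}, {d, a}}" "bd F2 = {{a, b}, {b, x}, {x, d'}, {d', a}}"
    using sq unfolding square_def by auto
  have E: "{a, b} \<in> edges G" "{b, x} \<in> edges G" "{x, d} \<in> edges G" "{d, a} \<in> edges G"
    "{x, d'} \<in> edges G" "{d', a} \<in> edges G"
    using bd bd_subset by blast+
  have V: "a \<in> verts G" "b \<in> verts G" "x \<in> verts G" using E edge_subset by blast+
  have pne: "p b \<noteq> p a" "p b \<noteq> p x" using inj_p V dist by (auto dest: inj_onD)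
  obtain g1 where g1: "arc g1" "pathstart g1 = p a" "pathfinish g1 = p b" "path_image g1 = path_image (c {a, b})"
    by (rule oriented_arc[OF E(1)])
  obtain g2 where g2: "arc g2" "pathstart g2 = p b" "pathfinish g2 = p x" "path_image g2 = path_image (c {b, x})"
    by (rule oriented_arc[OF E(2)])
  obtain h1 where h1: "arc h1" "pathstart h1 = p x" "pathfinish h1 = p d" "path_image h1 = path_image (c {x, d})"
    by (rule oriented_arc[OF E(3)])
  obtain h2 where h2: "arc h2" "pathstart h2 = p d" "pathfinish h2 = p a" "path_image h2 = path_image (c {d, a})"
    by (rule oriented_arc[OF E(4)])
  have int: "path_image (c e) \<inter> path_image (c e') = p ` (e \<inter> e')"
    if "e \<in> edges G" "e' \<in> edges G" "e \<noteq> e'" for e e' using curve_Int[OF that] .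
  \<comment> \<open>\<open>\<gamma>\<close> draws the common path \<open>a b x\<close>, and
    \<open>K\<close> carries the remaining edges of both squares, where \<open>d = d'\<close> is
    possible. The half \<open>x d a\<close> of the first square closes \<open>\<gamma>\<close>
    within \<open>K\<close>.\<close>
  define K where "K = curves {{x, d}, {d, a}, {x, d'}, {d', a}}"
  define \<gamma> where "\<gamma> = g1 +++ g2"
  define \<beta> where "\<beta> = h1 +++ h2"
  have ne: "{a, b} \<noteq> {b, x}" "{x, d} \<noteq> {d, a}"
    "{x, d} \<noteq> {a, b}" "{d, a} \<noteq> {a, b}" "{x, d'} \<noteq> {a, b}" "{d', a} \<noteq> {a, b}"
    "{x, d} \<noteq> {b, x}" "{d, a} \<noteq> {b, x}" "{x, d'} \<noteq> {b, x}" "{d', a} \<noteq> {b, x}"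
    using dist by (auto simp: doubleton_eq_iff)
  have \<gamma>: "arc \<gamma>" "pathstart \<gamma> = p a" "pathfinish \<gamma> = p x"
    "path_image \<gamma> = path_image (c {a, b}) \<union> path_image (c {b, x})"
  proof -
    have "path_image g1 \<inter> path_image g2 \<subseteq> {pathstart g2}"
      unfolding g1 g2 int[OF E(1,2) ne(1)] using dist by auto
    then show "arc \<gamma>" unfolding \<gamma>_def using g1 g2 by (intro arc_join) auto
  qed (simp_all add: \<gamma>_def g1 g2 path_image_join)
  have \<beta>: "arc \<beta>" "pathstart \<beta> = p x" "pathfinish \<beta> = p a"
    "path_image \<beta> = path_image (c {x, d}) \<union> path_image (c {d, a})"
  proof -
    have "path_image h1 \<inter> path_image h2 \<subseteq> {pathstart h2}"
      unfolding h1 h2 int[OF E(3,4) ne(2)] using dist by auto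
    then show "arc \<beta>" unfolding \<beta>_def using h1 h2 by (intro arc_join) auto
  qed (simp_all add: \<beta>_def h1 h2 path_image_join)
  have K4: "K = path_image (c {x, d}) \<union> path_image (c {d, a}) \<union> path_image (c {x, d'}) \<union> path_image (c {d', a})"
    unfolding K_def curves_def by blast
  have "K \<inter> path_image \<gamma> =
    p ` ({x, d} \<inter> {a, b}) \<union> p ` ({d, a} \<inter> {a, b}) \<union> p ` ({x, d'} \<inter> {a, b}) \<union> p ` ({d', a} \<inter> {a, b}) \<union>
    p ` ({x, d} \<inter> {b, x}) \<union> p ` ({d, a} \<inter> {b, x}) \<union> p ` ({x, d'} \<inter> {b, x}) \<union> p ` ({d', a} \<inter> {b, x})"
    unfolding K4 \<gamma>(4)
    by (simp only: Int_Un_distrib Int_Un_distrib2 int[OF E(3) E(1) ne(3)] int[OF E(4) E(1) ne(4)]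
      int[OF E(5) E(1) ne(5)] int[OF E(6) E(1) ne(6)] int[OF E(3) E(2) ne(7)] int[OF E(4) E(2) ne(8)]
      int[OF E(5) E(2) ne(9)] int[OF E(6) E(2) ne(10)] Un_ac)
  also have "\<dots> = {p a, p x}" using dist by auto
  finally have K\<gamma>: "K \<inter> path_image \<gamma> = {pathstart \<gamma>, pathfinish \<gamma>}" by (simp add: \<gamma>)
  have cK: "compact K" unfolding K_def using E by (intro compact_curves) blast
  interpret arc_chord \<gamma> \<beta> K
    using \<gamma> \<beta> cK K\<gamma> unfolding K4 by unfold_locales auto
  define Y where "Y = K \<union> path_image \<gamma>"
  have Y: "Y = curves (bd F1) \<union> curves (bd F2)"
    unfolding Y_def K4 \<gamma>(4) bd curves_def by auto
  have Yd: "Y \<subseteq> draw (edges G)" unfolding Y draw_def curves_def using bd_subset by blast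
  have deg: "\<exists>e\<in>edges G. v \<in> e" if "v \<in> verts G" for v using third_edge[OF that] by blast
  have comp: "F \<in> components (- Y)" if "F = F1 \<or> F = F2" for F
  proof (rule components_complementI)
    have F': "F \<in> faces" using that F by blast
    show "open F" "connected F" "F \<noteq> {}" using face_facts[OF F'] by simp_all
    show "F \<inter> Y = {}" using face_facts(4)[OF F'] Yd by blast
    show "frontier F \<subseteq> Y" using face_component_bd(1)[OF F' deg] that unfolding Y by blast
  qed
  have pb: "p b \<in> path_image \<gamma>" "p b \<notin> K"
  proof -
    show *: "p b \<in> path_image \<gamma>" unfolding \<gamma>(4) path_image_c[OF E(1)] by blast
    show "p b \<notin> K" using * K\<gamma> pne \<gamma>(2,3) by auto
  qed
  obtain r where r: "r > 0" "ball (p b) r \<subseteq> - K"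
    using pb(2) cK by (meson ComplI compact_imp_closed openE open_Compl)
  define D where "D = ball (p b) r"
  have D: "open D" "connected D" "p b \<in> D" "D \<inter> K = {}" using r unfolding D_def by auto
  have meets: "F \<inter> D \<noteq> {}" if "F = F1 \<or> F = F2" for F
  proof -
    have "eint {a, b} \<subseteq> closure F" using that bd unfolding bd_def by blast
    then have "closure (eint {a, b}) \<subseteq> closure F" by (simp add: closure_minimal)
    moreover have "p b \<in> closure (eint {a, b})"
      using curve_subset_closure_inner[OF E(1)] path_image_c[OF E(1)] by blast
    ultimately show ?thesis
      using D open_Int_closure_eq_empty[of D F] by blast
  qed
  have absorb: "D \<inter> S \<subseteq> F" if FF: "F = F1 \<or> F = F2" and S: "S = inside C \<or> S = outside C" and "F \<inter> D \<inter> S \<noteq> {}" for F S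
  proof
    fix z assume z: "z \<in> D \<inter> S"
    obtain y where y: "y \<in> F" "y \<in> D" "y \<in> S" using \<open>F \<inter> D \<inter> S \<noteq> {}\<close> by blast
    have "connected_component (- Y) y z"
      unfolding Y_def using same_side[OF D(2,4), of y z] y z S by blast
    then show "z \<in> F" using component_absorb[OF comp[OF FF] y(1)] by blast
  qed
  obtain e where e: "e \<in> edges G" "b \<in> e" "e \<noteq> {a, b}" "e \<noteq> {b, x}"
    using third_edge[OF V(2)] by blast
  have "p b \<in> closure (eint e)"
    using curve_subset_closure_inner[OF e(1)] path_image_c[OF e(1)] e(2) by blast
  then obtain y where y: "y \<in> D" "y \<in> eint e"
    using D open_Int_closure_eq_empty[of D "eint e"] by blast
  have "y \<notin> path_image \<gamma>"
    using inner_curve[OF e(1) E(1) e(3)] inner_curve[OF e(1) E(2) e(4)] y unfolding \<gamma>(4) by blast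
  then have "y \<in> D \<inter> inside C \<or> y \<in> D \<inter> outside C" using sides_cover[OF D(4)] y by blast
  then obtain S S' where S: "S = inside C \<or> S = outside C" "S' = inside C \<or> S' = outside C"
    "y \<in> S" "D - path_image \<gamma> = D \<inter> S \<union> D \<inter> S'"
    using sides_cover[OF D(4)] by blast
  have yF: "y \<notin> F" if "F = F1 \<or> F = F2" for F
    using that F face_facts(4) inner_in_draw[OF e(1)] y by blast
  \<comment> \<open>The third edge at \<open>b\<close> has its point \<open>y\<close> on side
    \<open>S\<close>. A face that met \<open>S\<close> within \<open>D\<close> would absorb
    \<open>y\<close>, so both faces approach \<open>b\<close> from \<open>S'\<close>, and each
    contains all of \<open>D \<inter> S'\<close>.\<close>
  have sub: "D \<inter> S' \<subseteq> F \<and> F \<inter> D \<inter> S' \<noteq> {}" if FF: "F = F1 \<or> F = F2" for F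
  proof -
    have "F \<inter> D \<inter> S = {}" using absorb[OF FF S(1)] yF[OF FF] y S by blast
    moreover have "F \<inter> D \<subseteq> D - path_image \<gamma>"
      using in_components_subset[OF comp[OF FF]] unfolding Y_def by blast
    ultimately have "F \<inter> D \<inter> S' \<noteq> {}" using meets[OF FF] S(4) by blast
    with absorb[OF FF S(2)] show ?thesis by blast
  qed
  have "F1 \<inter> F2 \<noteq> {}" using sub[of F1] sub[of F2] by blast
  then show False using F components_nonoverlap by metis
qed

text \<open>Let \<open>x y\<close> be a common edge of the squares \<open>x y z w\<close> and
  \<open>x y z' w'\<close>. A shared path of length two is excluded, so \<open>z \<noteq> z'\<close>
  and \<open>w \<noteq> w'\<close>; \<open>z = w'\<close> or \<open>z' = w\<close> would give a
  triangle. Hence \<open>x w z y z' w'\<close> is a hexagon.\<close>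

lemma squares_share_no_edge:
  assumes F: "F1 \<in> faces" "F2 \<in> faces" "F1 \<noteq> F2" "card (bd F1) = 4" "card (bd F2) = 4"
  shows "bd F1 \<inter> bd F2 = {}"
proof (rule ccontr)
  assume "bd F1 \<inter> bd F2 \<noteq> {}"
  then obtain e where e: "e \<in> bd F1" "e \<in> bd F2" by blast
  then obtain x y where xy: "e = {x, y}" using edgeE bd_subset by (metis subsetD)
  obtain z w where s1: "square (bd F1) x y z w"
    using bd_squares(2)[OF F(1,4)] square_rotate e(1) unfolding xy by metis
  obtain z' w' where s2: "square (bd F2) x y z' w'"
    using bd_squares(2)[OF F(2,5)] square_rotate e(2) unfolding xy by metis
  have "z \<noteq> z'" using squares_share_no_path[OF F(1-3)] s1 s2 by blast
  have "w \<noteq> w'" using squares_share_no_path[OF F(1-3)] square_reverse[OF s1] square_reverse[OF s2] by blast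
  have E: "{x, y} \<in> edges G" "{y, z} \<in> edges G" "{z, w} \<in> edges G" "{w, x} \<in> edges G"
    "{y, z'} \<in> edges G" "{z', w'} \<in> edges G" "{w', x} \<in> edges G"
    using s1 s2 bd_subset[of F1] bd_subset[of F2] unfolding square_def by auto
  have tri: False if "{x, v} \<in> edges G" "{y, v} \<in> edges G" for v
    using no_triangleD[OF triangle_free simple E(1) that(2,1)] .
  have "z \<noteq> w'" "z' \<noteq> w"
    using tri[of z] tri[of z'] E by (auto simp: insert_commute)
  then have "distinct [x, w, z, y, z', w']"
    using s1 s2 \<open>z \<noteq> z'\<close> \<open>w \<noteq> w'\<close> unfolding square_def by auto
  then show False
    using no_hexagonD[OF hexagon_free simple, of x w z y z' w'] E by (simp add: insert_commute)
qed

lemma handshake: "(\<Sum>v\<in>verts G. degree G v) = 2 * card (edges G)"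
proof -
  have "(\<Sum>v\<in>verts G. degree G v) = (\<Sum>v\<in>verts G. \<Sum>e\<in>edges G. of_bool (v \<in> e))"
    unfolding degree_def using finite_edges by (intro sum.cong) (auto simp: sum.If_cases of_bool_def Int_def)
  also have "\<dots> = (\<Sum>e\<in>edges G. \<Sum>v\<in>verts G. of_bool (v \<in> e))" by (rule sum.swap)
  also have "\<dots> = (\<Sum>e\<in>edges G. 2)"
  proof (rule sum.cong)
    fix e assume "e \<in> edges G"
    then have "verts G \<inter> e = e" "card e = 2"
      using edge_subset simple unfolding simple_graph_def by blast+
    then show "(\<Sum>v\<in>verts G. of_bool (v \<in> e)) = (2::nat)"
      using finite_verts by (simp add: of_bool_def sum.If_cases Int_def[symmetric])
  qed simp
  finally show ?thesis by simp
qed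

lemma edge_bound: "5 * card (edges G) + 20 \<le> 9 * card (verts G)"
proof -
  obtain S where S: "finite S" "S \<subseteq> faces" and euler: "card (edges G) + 2 \<le> card S + card (verts G)"
    using euler_inequality[OF nonempty] .
  define Q where "Q = {F \<in> S. card (bd F) = 4}"
  have Q: "finite Q" "Q \<subseteq> S" unfolding Q_def using S by auto
  have "(\<Sum>F\<in>S. card (bd F)) = (\<Sum>F\<in>S. \<Sum>e\<in>edges G. of_bool (e \<in> bd F))"
  proof (rule sum.cong)
    fix F
    have "edges G \<inter> bd F = bd F" using bd_subset by blast
    then show "card (bd F) = (\<Sum>e\<in>edges G. of_bool (e \<in> bd F))"
      using finite_edges by (simp add: of_bool_def sum.If_cases Int_def[symmetric])
  qed simp
  also have "\<dots> = (\<Sum>e\<in>edges G. \<Sum>F\<in>S. of_bool (e \<in> bd F))" by (rule sum.swap)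
  also have "\<dots> = (\<Sum>e\<in>edges G. card {F \<in> S. e \<in> bd F})"
    using S(1) by (intro sum.cong) (auto simp: of_bool_def sum.If_cases Int_def)
  also have "\<dots> \<le> (\<Sum>e\<in>edges G. 2)"
    using card_faces_at_edge[OF S(2)] by (intro sum_mono) blast
  finally have sum_bd: "(\<Sum>F\<in>S. card (bd F)) \<le> 2 * card (edges G)" by simp
  \<comment> \<open>Only a 4-face falls short of five boundary edges, and by exactly one.\<close>
  have "(\<Sum>F\<in>S. 5) \<le> (\<Sum>F\<in>S. card (bd F) + of_bool (F \<in> Q))"
  proof (rule sum_mono)
    fix F assume "F \<in> S"
    then show "5 \<le> card (bd F) + of_bool (F \<in> Q)"
      using bd_squares(1)[of F] S(2) unfolding Q_def by (cases "card (bd F) = 4") auto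
  qed
  moreover have "(\<Sum>F\<in>S. of_bool (F \<in> Q)) = card Q"
    using S(1) Q(2) by (simp add: of_bool_def sum.If_cases Int_absorb1 Int_def[symmetric])
  ultimately have faces_bound: "5 * card S \<le> 2 * card (edges G) + card Q"
    using sum_bd by (simp add: sum.distrib)
  have "(\<Sum>F\<in>Q. 4) = (\<Sum>F\<in>Q. card {v \<in> verts G. v \<in> \<Union>(bd F)})"
  proof (rule sum.cong)
    fix F assume "F \<in> Q"
    then obtain a b c d where sq: "square (bd F) a b c d"
      using bd_squares(2)[of F] S(2) unfolding Q_def by blast
    have "\<Union>(bd F) \<subseteq> verts G" using edge_subset bd_subset by blast
    then have "{v \<in> verts G. v \<in> \<Union>(bd F)} = \<Union>(bd F)" by blast
    also have "\<dots> = {a, b, c, d}" using sq unfolding square_def by auto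
    finally show "4 = card {v \<in> verts G. v \<in> \<Union>(bd F)}" using sq unfolding square_def by simp
  qed simp
  also have "\<dots> = (\<Sum>F\<in>Q. \<Sum>v\<in>verts G. of_bool (v \<in> \<Union>(bd F)))"
    using finite_verts by (intro sum.cong) (auto simp: of_bool_def sum.If_cases Int_def)
  also have "\<dots> = (\<Sum>v\<in>verts G. \<Sum>F\<in>Q. of_bool (v \<in> \<Union>(bd F)))" by (rule sum.swap)
  also have "\<dots> = (\<Sum>v\<in>verts G. card {F \<in> Q. v \<in> \<Union>(bd F)})"
    using Q(1) by (intro sum.cong) (auto simp: of_bool_def sum.If_cases Int_def)
  finally have four: "4 * card Q = (\<Sum>v\<in>verts G. card {F \<in> Q. v \<in> \<Union>(bd F)})" by simp
  have loc: "card {F \<in> Q. v \<in> \<Union>(bd F)} + 2 \<le> degree G v" if v: "v \<in> verts G" for v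
  proof -
    define R where "R = {F \<in> Q. v \<in> \<Union>(bd F)}"
    have "finite R" unfolding R_def using Q by simp
    define inc where "inc F = {e \<in> bd F. v \<in> e}" for F
    have two: "card (inc F) = 2" if F: "F \<in> R" for F
    proof -
      obtain a b c d where sq: "square (bd F) a b c d"
        using F bd_squares(2)[of F] S(2) unfolding R_def Q_def by blast
      obtain e where e: "e \<in> bd F" "v \<in> e" using F unfolding R_def by blast
      have "e \<in> edges G" using e(1) bd_subset by blast
      then obtain y where "e = {v, y}" using e(2) by (elim edgeE) auto
      then obtain z w where "square (bd F) v y z w" using square_rotate[OF sq] e(1) by blast
      then have "distinct [v, y, z, w]" "inc F = {{v, y}, {w, v}}"
        unfolding square_def inc_def by auto
      then show ?thesis by (simp add: doubleton_eq_iff)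
    qed
    have "2 * card R = (\<Sum>F\<in>R. card (inc F))" using two by simp
    also have "\<dots> = card (\<Union>F\<in>R. inc F)"
    proof (rule card_UN_disjoint[symmetric])
      show "\<forall>F\<in>R. finite (inc F)" using two by (metis card.infinite zero_neq_numeral)
      show "\<forall>F\<in>R. \<forall>F'\<in>R. F \<noteq> F' \<longrightarrow> inc F \<inter> inc F' = {}"
        using squares_share_no_edge S(2) unfolding R_def Q_def inc_def by blast
    qed fact
    also have "\<dots> \<le> degree G v"
      unfolding degree_def inc_def using finite_edges bd_subset by (intro card_mono) auto
    finally have "2 * card R \<le> degree G v" .
    \<comment> \<open>Integrality matters for degree 3, where \<open>2 * card R \<le> 3\<close>
      leaves \<open>card R \<le> 1\<close>.\<close>
    then show ?thesis using min_deg[OF v] unfolding R_def[symmetric] by linarith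
  qed
  have "(\<Sum>v\<in>verts G. card {F \<in> Q. v \<in> \<Union>(bd F)} + 2) \<le> (\<Sum>v\<in>verts G. degree G v)"
    using loc by (rule sum_mono)
  then have "4 * card Q + 2 * card (verts G) \<le> 2 * card (edges G)"
    unfolding handshake four sum.distrib by simp
  \<comment> \<open>Eliminating \<open>card Q\<close> gives 20 f \<le> 10 e - 2 n, and Euler's
    inequality then yields 20 (e + 2) \<le> 10 e + 18 n.\<close>
  with faces_bound euler show ?thesis by linarith
qed

end

lemma floor_bound_iff:
  fixes m n :: nat
  shows "int m \<le> \<lfloor>(9 / 5 :: real) * real n - 4\<rfloor> \<longleftrightarrow> 5 * m + 20 \<le> 9 * n"
proof -
  have "int m \<le> \<lfloor>(9 / 5 :: real) * real n - 4\<rfloor> \<longleftrightarrow> real m \<le> 9 / 5 * real n - 4"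
    unfolding le_floor_iff by simp
  also have "\<dots> \<longleftrightarrow> real (5 * m + 20) \<le> real (9 * n)" by auto
  finally show ?thesis by (simp only: of_nat_le_iff)
qed

lemma planar_edge_bound:
  assumes "simple_graph G" "verts G \<noteq> {}" "planar G"
    "subgraph_free (cycle_graph 6) G" "subgraph_free (cycle_graph 3) G" "min_degree G \<ge> 3"
  shows "int (card (edges G)) \<le> \<lfloor>(9 / 5 :: real) * real (card (verts G)) - 4\<rfloor>"
proof -
  obtain p c where "plane_drawing G p c" using assms(3) unfolding planar_def by blast
  moreover have "3 \<le> degree G v" if "v \<in> verts G" for v
  proof -
    have "finite (degree G ` verts G)" using assms(1) unfolding simple_graph_def by simp
    then have "min_degree G \<le> degree G v" unfolding min_degree_def using that by simp
    then show ?thesis using assms(6) by simp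
  qed
  ultimately interpret dense_plane_graph G p c
    using assms by unfold_locales auto
  show ?thesis unfolding floor_bound_iff by (rule edge_bound)
qed

subsection \<open>Two-page book drawings\<close>

text \<open>For \<open>s = 1\<close> or \<open>s = - 1\<close> and \<open>a < b\<close> this is the
  upper or lower half of the circle with diameter from \<open>a\<close> to \<open>b\<close>. It is
  parametrised by the abscissa, which makes injectivity immediate.\<close>

definition arch :: "real \<Rightarrow> real \<Rightarrow> real \<Rightarrow> real \<Rightarrow> complex" where
  "arch s a b t = Complex (a + (b - a) * t) (s * ((b - a) * sqrt (t * (1 - t))))"

lemma arc_arch:
  assumes "a < b"
  shows "arc (arch s a b)" "pathstart (arch s a b) = of_real a" "pathfinish (arch s a b) = of_real b"
proof -
  have "path (arch s a b)"
    unfolding path_def arch_def Complex_eq by (intro continuous_intros)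
  moreover have "inj_on (arch s a b) {0..1}"
    using assms unfolding arch_def by (auto intro!: inj_onI)
  ultimately show "arc (arch s a b)" unfolding arc_def by blast
qed (simp_all add: pathstart_def pathfinish_def arch_def complex_eq_iff)

lemma arch_interior:
  assumes "a < b" "t \<in> {0<..<1}" and z: "z = arch s a b t"
  shows "a < Re z" "Re z < b" "s \<noteq> 0 \<Longrightarrow> 0 < s * Im z" "(Im z)\<^sup>2 = s\<^sup>2 * ((Re z - a) * (b - Re z))"
proof -
  have t: "0 < t" "t < 1" using assms by auto
  show "a < Re z" using assms t by (simp add: arch_def)
  have "(b - a) * t < (b - a) * 1" using assms t by (intro mult_strict_left_mono) auto
  then show "Re z < b" using z by (simp add: arch_def)
  have "0 < (b - a) * sqrt (t * (1 - t))" using assms t by simp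
  moreover have "s * Im z = s\<^sup>2 * ((b - a) * sqrt (t * (1 - t)))"
    using z by (simp add: arch_def power2_eq_square)
  ultimately show "0 < s * Im z" if "s \<noteq> 0"
    using that by simp
  have "(sqrt (t * (1 - t)))\<^sup>2 = t * (1 - t)" using t by simp
  then show "(Im z)\<^sup>2 = s\<^sup>2 * ((Re z - a) * (b - Re z))"
    using z by (simp add: arch_def power_mult_distrib) (simp add: power2_eq_square algebra_simps)
qed

text \<open>Of two half circles over nested intervals, the one over the larger interval is strictly
  higher. Hence half circles that meet at an inner point have interleaving intervals.\<close>

lemma equal_height_less:
  fixes a b a' b' x :: real
  assumes "a < x" "x < b" "a' < x" "x < b'" "(x - a) * (b - x) = (x - a') * (b' - x)" "a < a'"
  shows "b < b'"
proof (rule ccontr)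
  assume "\<not> b < b'"
  then have "(x - a') * (b' - x) \<le> (x - a') * (b - x)"
    using assms by (intro mult_left_mono) auto
  also have "\<dots> < (x - a) * (b - x)"
    using assms by (intro mult_strict_right_mono) auto
  finally show False using assms by simp
qed

text \<open>The vertices lie on the real axis, and an edge of the first page is drawn in the upper half
  plane, an edge of the second page in the lower one. Relation \<open>R\<close> collects the intervals allowed on
  the first page; the second page is its mirror image.\<close>

lemma two_page_planar:
  fixes pos :: "'a \<Rightarrow> int" and G :: "'a ugraph"
  assumes simple: "simple_graph G" and inj: "inj_on pos (verts G)"
    and nc: "\<And>a b a' b'. R a b \<Longrightarrow> R a' b' \<Longrightarrow> a < a' \<Longrightarrow> a' < b \<Longrightarrow> b < b' \<Longrightarrow> False"
    and pages: "\<And>e. e \<in> edges G \<Longrightarrow> \<exists>a b. pos ` e = {a, b} \<and> a < b \<and> (R a b \<or> R (- b) (- a))"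
  shows "planar G"
proof -
  obtain A B where AB: "\<And>e. e \<in> edges G \<Longrightarrow> pos ` e = {A e, B e} \<and> A e < B e \<and> (R (A e) (B e) \<or> R (- B e) (- A e))"
    using pages by metis
  define s where "s e = (if R (A e) (B e) then 1 else - 1 :: real)" for e
  define p where "p v = complex_of_real (of_int (pos v))" for v
  define c where "c e = arch (s e) (of_int (A e)) (of_int (B e))" for e
  have s: "s e \<noteq> 0" "(s e)\<^sup>2 = 1" for e unfolding s_def by auto
  have lt: "(of_int (A e) :: real) < of_int (B e)" if "e \<in> edges G" for e using AB[OF that] by simp
  have interior: "of_int (A e) < Re z \<and> Re z < of_int (B e) \<and> 0 < s e * Im z \<and>
      (Im z)\<^sup>2 = (Re z - of_int (A e)) * (of_int (B e) - Re z)"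
    if "e \<in> edges G" "z \<in> c e ` {0<..<1}" for e z
    using that arch_interior[OF lt[OF that(1)], of _ z "s e"] s unfolding c_def by auto
  have vert: "Im (p v) = 0" for v unfolding p_def by simp
  have ends: "{pathstart (c e), pathfinish (c e)} = p ` e" if "e \<in> edges G" for e
  proof -
    have "p ` e = (\<lambda>i. complex_of_real (of_int i)) ` pos ` e" unfolding p_def by (simp add: image_image)
    then show ?thesis
      using AB[OF that] arc_arch[OF lt[OF that]] unfolding c_def by simp
  qed
  have disjoint: "z \<notin> path_image (c e')"
    if ee: "e \<in> edges G" "e' \<in> edges G" "e \<noteq> e'" and z: "z \<in> c e ` {0<..<1}" for e e' z
  proof
    assume "z \<in> path_image (c e')"
    then obtain t where t: "t \<in> {0..1}" "z = c e' t" unfolding path_image_def by blast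
    note i = interior[OF ee(1) z]
    have "t \<noteq> 0 \<and> t \<noteq> 1"
    proof (rule ccontr)
      assume "\<not> ?thesis"
      then have "z \<in> {pathstart (c e'), pathfinish (c e')}"
        using t(2) by (auto simp: pathstart_def pathfinish_def)
      then have "Im z = 0" unfolding ends[OF ee(2)] using vert by blast
      then show False using i by simp
    qed
    then have "z \<in> c e' ` {0<..<1}" using t by (simp add: image_iff) (metis greaterThanLessThan_iff order_le_less)
    note i' = interior[OF ee(2) this]
    have "0 < s e * Im z" "0 < s e' * Im z" using i i' by auto
    then have ss: "s e = s e'" unfolding s_def by (auto split: if_splits)
    have no: False if "R (A e) (B e) = R (A e') (B e')" "A e < A e'" "e \<in> edges G" "e' \<in> edges G"
      "real_of_int (A e) < Re z" "Re z < of_int (B e)" "real_of_int (A e') < Re z" "Re z < of_int (B e')"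
      "(Re z - of_int (A e)) * (of_int (B e) - Re z) = (Re z - of_int (A e')) * (of_int (B e') - Re z)" for e e'
    proof -
      have "A e' < B e" using that by linarith
      moreover have "B e < B e'"
        using equal_height_less[OF that(5-9)] that(2) by simp
      \<comment> \<open>On the second page both intervals are negated, which reverses their order;
        the second instance of \<open>nc\<close> therefore exchanges the roles of \<open>e\<close>
        and \<open>e'\<close>.\<close>
      ultimately show False
        using nc[of "A e" "B e" "A e'" "B e'"] nc[of "- B e'" "- A e'" "- B e" "- A e"] that(1,2)
          AB[OF that(3)] AB[OF that(4)] by auto
    qed
    have RR: "R (A e) (B e) = R (A e') (B e')" using ss unfolding s_def by (auto split: if_splits)
    have eq: "(Re z - of_int (A e)) * (of_int (B e) - Re z) = (Re z - of_int (A e')) * (of_int (B e') - Re z)"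
      using i i' by simp
    have "\<not> A e < A e'" using no[OF RR _ ee(1,2) _ _ _ _ eq] i i' by blast
    moreover have "\<not> A e' < A e" using no[OF RR[symmetric] _ ee(2,1) _ _ _ _ eq[symmetric]] i i' by blast
    ultimately have "A e = A e'" by simp
    then have "B e = B e'" using i i' by auto
    with \<open>A e = A e'\<close> have "pos ` e = pos ` e'" using AB ee by metis
    then have "e = e'"
      using inj ee simple inj_on_image_eq_iff[OF inj] unfolding simple_graph_def by blast
    with ee show False by blast
  qed
  have "plane_drawing G p c"
    unfolding plane_drawing_def
  proof (intro conjI ballI impI)
    show "inj_on p (verts G)" using inj unfolding p_def inj_on_def by simp
    show "arc (c e)" if "e \<in> edges G" for e unfolding c_def by (rule arc_arch[OF lt[OF that]])
    show "{pathstart (c e), pathfinish (c e)} = p ` e" if "e \<in> edges G" for e by (rule ends[OF that])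
    show "c e ` {0<..<1} \<inter> p ` verts G = {}" if "e \<in> edges G" for e
    proof (rule ccontr)
      assume "c e ` {0<..<1} \<inter> p ` verts G \<noteq> {}"
      then obtain z where z: "z \<in> c e ` {0<..<1}" "z \<in> p ` verts G" by blast
      then have "Im z = 0" using vert by auto
      with interior[OF that z(1)] show False by simp
    qed
    show "c e ` {0<..<1} \<inter> path_image (c e') = {}" if "e \<in> edges G" "e' \<in> edges G" "e \<noteq> e'" for e e'
      using disjoint[OF that] by blast
  qed
  then show ?thesis unfolding planar_def by blast
qed

subsection \<open>The extremal tube\<close>

text \<open>Vertex \<open>2 * q + s\<close> with \<open>s < 2\<close> lies at height \<open>q\<close> on the right (\<open>s = 0\<close>) or on the left
  (\<open>s = 1\<close>) part of a closed curve through all vertices. A period of twenty labels covers two rings, and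
  \<open>(r, d)\<close> in \<open>steps\<close> joins each \<open>x\<close> with \<open>x mod 20 = r\<close> to \<open>x + d\<close>.\<close>

definition steps :: "(nat \<times> nat) list" where
  "steps = [(0, 2), (0, 6), (1, 2), (1, 6), (2, 2), (2, 7), (2, 9), (3, 2), (3, 5), (3, 7),
    (4, 2), (4, 12), (5, 2), (5, 12), (6, 2), (6, 4), (7, 2), (7, 4), (10, 4), (10, 9),
    (11, 4), (11, 7), (12, 16), (12, 2), (12, 7), (13, 16), (13, 2), (13, 5), (14, 6), (14, 2),
    (15, 6), (15, 2), (16, 2), (17, 2), (18, 2), (19, 2)]"

text \<open>The ends keep the labels of the adjacent periods 0 and M + 1, and most of these pairs
  are ordinary steps of those periods. The exceptions are the four pairs with difference 6, which
  complete the two end 4-cycles.\<close>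

definition caps :: "nat \<Rightarrow> (nat \<times> nat) list" where
  "caps M = [(12, 28), (12, 19), (13, 29), (13, 18), (18, 20), (19, 21), (12, 18), (13, 19),
    (20 * M + 20, 20 * M + 22), (20 * M + 21, 20 * M + 23), (20 * M + 22, 20 * M + 29),
    (20 * M + 23, 20 * M + 28), (20 * M + 22, 20 * M + 28), (20 * M + 23, 20 * M + 29)]"

definition arcs :: "nat \<Rightarrow> (nat \<times> nat) set" where
  "arcs M = (\<lambda>(k, r, d). (20 * k + r, 20 * k + r + d)) ` ({1..M} \<times> set steps) \<union> set (caps M)"

definition tube :: "nat \<Rightarrow> nat ugraph" where
  "tube M = \<lparr>verts = {12, 13, 18, 19} \<union> {20..20 * M + 23} \<union> {20 * M + 28, 20 * M + 29},
    edges = (\<lambda>(x, y). {x, y}) ` arcs M\<rparr>"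

definition adj :: "nat \<Rightarrow> nat \<Rightarrow> nat \<Rightarrow> bool" where
  "adj M x y \<longleftrightarrow> (x, y) \<in> arcs M \<or> (y, x) \<in> arcs M"

lemma steps_bounds: "(r, d) \<in> set steps \<Longrightarrow> r < 20 \<and> 0 < d \<and> d \<le> 16 \<and> r + d \<le> 29 \<and> r + d \<noteq> 24 \<and> r + d \<noteq> 25 \<and> r + d \<noteq> 26 \<and> r + d \<noteq> 27"
  unfolding steps_def by auto

lemma arcsE:
  assumes "(x, y) \<in> arcs M"
  obtains k r d where "1 \<le> k" "k \<le> M" "(r, d) \<in> set steps" "x = 20 * k + r" "y = 20 * k + r + d"
  | "(x, y) \<in> set (caps M)"
  using assms unfolding arcs_def by auto

lemma arcs_verts:
  assumes "(x, y) \<in> arcs M"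
  shows "x < y \<and> y \<le> x + 16 \<and> x \<in> verts (tube M) \<and> y \<in> verts (tube M)"
  using assms
proof (cases rule: arcsE)
  case (1 k r d)
  have "20 \<le> 20 * k" "20 * k \<le> 20 * M" using 1 by auto
  moreover have "20 * k + 20 \<le> 20 * M" if "k \<noteq> M" using 1 that by auto
  ultimately show ?thesis using steps_bounds[OF 1(3)] 1 unfolding tube_def by (cases "k = M") auto
qed (auto simp: caps_def tube_def)

lemma edges_tube: "{x, y} \<in> edges (tube M) \<longleftrightarrow> adj M x y"
  unfolding tube_def adj_def by (auto simp: doubleton_eq_iff image_iff split: prod.splits)

lemma simple_tube: "simple_graph (tube M)"
  unfolding simple_graph_def
proof (intro conjI ballI)
  show "finite (verts (tube M))" unfolding tube_def by simp
  fix e assume "e \<in> edges (tube M)"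
  then obtain x y where "(x, y) \<in> arcs M" "e = {x, y}" unfolding tube_def by auto
  with arcs_verts[of x y M] show "e \<subseteq> verts (tube M)" "card e = 2" by auto
qed

lemma card_verts_tube: "card (verts (tube M)) = 20 * M + 10"
proof -
  have "card ({12, 13, 18, 19} \<union> {20..20 * M + 23} \<union> {20 * M + 28, 20 * M + 29}) = 4 + (20 * M + 4) + (2 :: nat)"
    by (subst card_Un_disjoint; (subst card_Un_disjoint)?) auto
  then show ?thesis unfolding tube_def by simp
qed

lemma card_edges_tube: "card (edges (tube M)) = 36 * M + 14"
proof -
  define f where "f = (\<lambda>(k :: nat, r, d :: nat). (20 * k + r, 20 * k + r + d))"
  have "inj_on f ({1..M} \<times> set steps)"
  proof (rule inj_onI)
    fix u v assume u: "u \<in> {1..M} \<times> set steps" and v: "v \<in> {1..M} \<times> set steps" and eq: "f u = f v"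
    obtain k r d k' r' d' where uv: "u = (k, r, d)" "v = (k', r', d')" by (metis prod_cases3)
    have "r < 20" "r' < 20" using u v steps_bounds unfolding uv by blast+
    then have k: "k = (20 * k + r) div 20" "k' = (20 * k' + r') div 20" by simp_all
    have e: "20 * k + r = 20 * k' + r'" "20 * k + r + d = 20 * k' + r' + d'"
      using eq unfolding uv f_def by simp_all
    have "k = k'" using k e(1) by metis
    with e show "u = v" unfolding uv by simp
  qed
  then have "card (f ` ({1..M} \<times> set steps)) = M * 36"
    by (subst card_image) (simp_all add: card_cartesian_product steps_def)
  moreover have "card (set (caps M)) = 14" unfolding caps_def by simp
  moreover have "f ` ({1..M} \<times> set steps) \<inter> set (caps M) = {}"
    using steps_bounds unfolding f_def caps_def by fastforce
  ultimately have "card (arcs M) = M * 36 + 14"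
    unfolding arcs_def f_def[symmetric] by (subst card_Un_disjoint) auto
  moreover have "inj_on (\<lambda>(x, y). {x, y}) (arcs M)"
  proof (rule inj_onI, clarify)
    fix x y x' y' assume "(x, y) \<in> arcs M" "(x', y') \<in> arcs M" "{x, y} = {x', y'}"
    then show "x = x' \<and> y = y'"
      using arcs_verts[of x y M] arcs_verts[of x' y' M] by (auto simp: doubleton_eq_iff)
  qed
  ultimately show ?thesis unfolding tube_def by (simp add: card_image)
qed

section \<open>The book embedding of the tube\<close>

definition pos :: "nat \<Rightarrow> int" where
  "pos x = (if even x then int (x div 2) else - int (x div 2))"

text \<open>Exchanging the labels 2 q and 2 q + 1 is a symmetry of the tube that negates
  \<open>pos\<close> and so swaps the pages. One interval is listed for each pair of mirror edges;
  edges between neighbouring positions fit on either page and are treated in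
  \<open>page\<close>.\<close>

definition page_period :: "int \<Rightarrow> (int \<times> int) set" where
  "page_period k = {(10 * k, 10 * k + 3), (10 * k + 7, 10 * k + 10), (10 * k + 6, 10 * k + 14),
    (- (10 * k + 8), - (10 * k + 2)), (- (10 * k + 5), - (10 * k + 3)), (- (10 * k + 7), - (10 * k + 5)),
    (- (10 * k + 9), 10 * k + 5), (- (10 * k + 9), 10 * k + 6), (- (10 * k + 1), 10 * k + 4), (- (10 * k + 1), 10 * k + 5)}"

definition page_caps :: "int \<Rightarrow> (int \<times> int) set" where
  "page_caps M = {(6, 9), (6, 14), (- 9, 6), (10 * M + 11, 10 * M + 14), (- (10 * M + 11), 10 * M + 14)}"

definition page :: "int \<Rightarrow> int \<Rightarrow> int \<Rightarrow> bool" where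
  "page M a b \<longleftrightarrow> b = a + 1 \<or> (a, b) \<in> page_caps M \<or> (\<exists>k. 1 \<le> k \<and> k \<le> M \<and> (a, b) \<in> page_period k)"

lemma page_noncrossing:
  assumes "page M a b" "page M a' b'" "0 \<le> M" and lt: "a < a'" "a' < b" "b < b'"
  shows False
proof -
  have "b \<noteq> a + 1" "b' \<noteq> a' + 1" using lt by auto
  with assms consider "(a, b) \<in> page_caps M" "(a', b') \<in> page_caps M"
    | k where "1 \<le> k" "k \<le> M" "(a, b) \<in> page_caps M" "(a', b') \<in> page_period k"
    | k where "1 \<le> k" "k \<le> M" "(a, b) \<in> page_period k" "(a', b') \<in> page_caps M"
    | k k' where "(a, b) \<in> page_period k" "(a', b') \<in> page_period k'" "1 \<le> k" "1 \<le> k'"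
    unfolding page_def by blast
  then show False
  proof cases
    case 1
    then show False using lt \<open>0 \<le> M\<close> unfolding page_caps_def by auto
  next
    case 2
    then show False using lt unfolding page_caps_def page_period_def by (auto; presburger)
  next
    case 3
    then show False using lt unfolding page_caps_def page_period_def by (auto; presburger)
  next
    case 4
    \<comment> \<open>All ends of intervals of period \<open>k\<close> have absolute value between
      10 k and 10 k + 14, so only equal and adjacent periods overlap.\<close>
    consider "k + 2 \<le> k'" | "k' = k + 1" | "k = k'" | "k = k' + 1" | "k' + 2 \<le> k" by linarith
    then show False
      by cases (use 4 lt in \<open>unfold page_period_def, elim insertE emptyE Pair_inject; linarith\<close>)+
  qed
qed

lemma page_arcs:
  assumes "(x, y) \<in> arcs M"
  shows "\<exists>a b. pos ` {x, y} = {a, b} \<and> a < b \<and> (page (int M) a b \<or> page (int M) (- b) (- a))"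
  using assms
proof (cases rule: arcsE)
    case (1 k r d)
    have "(20 * k + j) div 2 = 10 * k + j div 2" "even (20 * k + j) = even j" for j by presburger+
    then have p: "pos (20 * k + j) = (if even j then 10 * int k + int (j div 2) else - (10 * int k + int (j div 2)))" for j
      unfolding pos_def by simp
    define ok where "ok a b \<longleftrightarrow> a < b \<and> (b = a + 1 \<or> (a, b) \<in> page_period (int k) \<or> (- b, - a) \<in> page_period (int k))" for a b
    have k: "1 \<le> int k" "int k \<le> int M" using 1 by auto
    have "(r, d) \<in> set steps \<Longrightarrow> ok (pos (20 * k + r)) (pos (20 * k + (r + d))) \<or> ok (pos (20 * k + (r + d))) (pos (20 * k + r))"
      using k(1) unfolding steps_def p
      by (simp only: list.set, elim insertE emptyE Pair_inject) (simp_all add: ok_def page_period_def)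
    then have "ok (pos x) (pos y) \<or> ok (pos y) (pos x)"
      using 1 by (simp add: add.assoc)
    moreover have "page (int M) a b \<or> page (int M) (- b) (- a)" if "ok a b" for a b
      using that k unfolding ok_def page_def by auto
    ultimately show ?thesis
      unfolding ok_def by (elim disjE) (auto simp: insert_commute)
  next
    case 2
    have p: "pos (20 * M + j) = (if even j then 10 * int M + int (j div 2) else - (10 * int M + int (j div 2)))" for j
    proof -
      have "(20 * M + j) div 2 = 10 * M + j div 2" "even (20 * M + j) = even j" by presburger+
      then show ?thesis unfolding pos_def by simp
    qed
    define ok where "ok a b \<longleftrightarrow> a < b \<and> (b = a + 1 \<or> (a, b) \<in> page_caps (int M) \<or> (- b, - a) \<in> page_caps (int M))" for a b
    have n: "pos 12 = 6" "pos 13 = - 6" "pos 18 = 9" "pos 19 = - 9" "pos 20 = 10" "pos 21 = - 10" "pos 28 = 14" "pos 29 = - 14"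
      by (simp_all add: pos_def)
    have "ok (pos x) (pos y) \<or> ok (pos y) (pos x)"
      using 2 unfolding caps_def
      by (simp only: list.set, elim insertE emptyE Pair_inject) (simp_all add: p n ok_def page_caps_def)
    moreover have "page (int M) a b \<or> page (int M) (- b) (- a)" if "ok a b" for a b
      using that unfolding ok_def page_def by auto
    ultimately show ?thesis
      unfolding ok_def by (elim disjE) (auto simp: insert_commute)
qed

lemma planar_tube: "planar (tube M)"
proof (rule two_page_planar[OF simple_tube])
  show "inj_on pos (verts (tube M))"
  proof (rule inj_onI)
    fix x y assume "x \<in> verts (tube M)" "y \<in> verts (tube M)" "pos x = pos y"
    \<comment> \<open>The labels 0 and 1 would share position 0; the tube stays clear of
      them.\<close>
    then have "12 \<le> x" "12 \<le> y" unfolding tube_def by auto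
    with \<open>pos x = pos y\<close> show "x = y" unfolding pos_def by (auto split: if_splits elim!: evenE oddE)
  qed
  show False if "page (int M) a b" "page (int M) a' b'" "a < a'" "a' < b" "b < b'" for a b a' b'
    using page_noncrossing[OF that(1,2) _ that(3-5)] by simp
  show "\<exists>a b. pos ` e = {a, b} \<and> a < b \<and> (page (int M) a b \<or> page (int M) (- b) (- a))"
    if "e \<in> edges (tube M)" for e
  proof -
    from that obtain x y where "(x, y) \<in> arcs M" "e = {x, y}" unfolding tube_def by auto
    then show ?thesis using page_arcs by simp
  qed
qed

section \<open>The minimum degree of the tube\<close>

lemma adj_sym: "adj M x y \<longleftrightarrow> adj M y x"
  unfolding adj_def by blast

lemma adj_step:
  assumes "1 \<le> k" "k \<le> M" "(r, d) \<in> set steps"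
  shows "adj M (20 * k + r) (20 * k + (r + d))"
  using assms unfolding adj_def arcs_def by (auto intro!: image_eqI[of _ _ "(k, r, d)"])

lemma degree_tube_ge:
  assumes "adj M v x" "adj M v y" "adj M v z" "distinct [x, y, z]"
  shows "3 \<le> degree (tube M) v"
proof -
  have "{{v, x}, {v, y}, {v, z}} \<subseteq> {e \<in> edges (tube M). v \<in> e}"
    using assms by (auto simp: edges_tube)
  moreover have "finite {e \<in> edges (tube M). v \<in> e}"
    unfolding tube_def arcs_def by auto
  ultimately have "card {{v, x}, {v, y}, {v, z}} \<le> degree (tube M) v"
    unfolding degree_def by (intro card_mono)
  then show ?thesis using assms(4) by (simp add: doubleton_eq_iff)
qed

lemma tube_neighbours:
  assumes M: "1 \<le> M" and v: "v \<in> verts (tube M)"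
  shows "\<exists>x y z. adj M v x \<and> adj M v y \<and> adj M v z \<and> distinct [x, y, z]"
proof -
  have cap: "adj M x y" if "(x, y) \<in> set (caps M) \<or> (y, x) \<in> set (caps M)" for x y
    using that unfolding adj_def arcs_def by blast
  have step: "adj M (20 * k + r) (20 * k + s)" if "1 \<le> k" "k \<le> M" "(r, s - r) \<in> set steps \<and> r < s \<or> (s, r - s) \<in> set steps \<and> s < r" for k r s
    using adj_step[OF that(1,2), of r "s - r"] adj_step[OF that(1,2), of s "r - s"] that(3) adj_sym by auto
  consider "v \<in> {12, 13, 18, 19}" | k r where "1 \<le> k" "k \<le> M" "r < 20" "v = 20 * k + r"
    | j where "v = 20 * M + j" "j \<in> {20, 21, 22, 23, 28, 29}"
  proof -
    assume c: "v \<in> {12, 13, 18, 19} \<Longrightarrow> thesis" "\<And>k r. 1 \<le> k \<Longrightarrow> k \<le> M \<Longrightarrow> r < 20 \<Longrightarrow> v = 20 * k + r \<Longrightarrow> thesis"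
      "\<And>j. v = 20 * M + j \<Longrightarrow> j \<in> {20, 21, 22, 23, 28, 29} \<Longrightarrow> thesis"
    show thesis
    proof (cases "20 \<le> v \<and> v < 20 * M + 20")
      case True
      then have "1 \<le> v div 20" "v div 20 \<le> M" by (auto simp: div_le_mono less_eq_div_iff_mult_less_eq)
      then show thesis using c(2)[of "v div 20" "v mod 20"] by simp
    next
      case False
      then consider "v \<in> {12, 13, 18, 19}" | "20 * M + 20 \<le> v" "v \<le> 20 * M + 23" | "v \<in> {20 * M + 28, 20 * M + 29}"
        using v unfolding tube_def by auto
      then show thesis
      proof cases
        case 2
        then have "v - 20 * M = 20 \<or> v - 20 * M = 21 \<or> v - 20 * M = 22 \<or> v - 20 * M = 23" by linarith
        then show thesis by (intro c(3)[of "v - 20 * M"]) (use 2 in auto)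
      qed (use c(1,3) in auto)
    qed
  qed
  then show ?thesis
  proof cases
    case 1
    then consider "v = 12" | "v = 13" | "v = 18" | "v = 19" by blast
    then show ?thesis
    proof cases
      case 1 then show ?thesis by (intro exI[of _ 28] exI[of _ 19] exI[of _ 18]) (auto intro!: cap simp: caps_def)
    next
      case 2 then show ?thesis by (intro exI[of _ 29] exI[of _ 18] exI[of _ 19]) (auto intro!: cap simp: caps_def)
    next
      case 3 then show ?thesis by (intro exI[of _ 12] exI[of _ 13] exI[of _ 20]) (auto intro!: cap simp: caps_def)
    next
      case 4 then show ?thesis by (intro exI[of _ 12] exI[of _ 13] exI[of _ 21]) (auto intro!: cap simp: caps_def)
    qed
  next
    case (2 k r)
    have three: ?thesis if "(r, s - r) \<in> set steps \<and> r < s \<or> (s, r - s) \<in> set steps \<and> s < r"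
      "(r, t - r) \<in> set steps \<and> r < t \<or> (t, r - t) \<in> set steps \<and> t < r"
      "(r, u - r) \<in> set steps \<and> r < u \<or> (u, r - u) \<in> set steps \<and> u < r" "distinct [s, t, u]" for s t u
      using step[OF 2(1,2) that(1)] step[OF 2(1,2) that(2)] step[OF 2(1,2) that(3)] that(4) 2(4)
      by (intro exI[of _ "20 * k + s"] exI[of _ "20 * k + t"] exI[of _ "20 * k + u"]) auto
    \<comment> \<open>A neighbour in the previous period. For \<open>k = 1\<close> the edge comes
      from the lower cap, whose labels imitate period 0, so the same difference \<open>d\<close>
      serves.\<close>
    have below: "adj M (20 * k + r) (20 * k + r - d)" if d: "r < d" "d \<le> 20" "(20 + r - d, d) \<in> set steps"
      and bot: "(20 + r - d, 20 + r) \<in> set (caps M)" for d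
    proof (cases "k = 1")
      case True
      then show ?thesis using cap[of "20 + r" "20 + r - d"] bot by simp
    next
      case False
      have A: "20 * (k - 1) + (20 + r - d) = 20 * k + r - d" "20 * (k - 1) + (20 + r - d + d) = 20 * k + r"
        using 2(1) d by (simp_all add: diff_mult_distrib2)
      have "adj M (20 * (k - 1) + (20 + r - d)) (20 * (k - 1) + (20 + r - d + d))"
        using False 2(1,2) by (intro adj_step d) auto
      then show ?thesis unfolding A using adj_sym by blast
    qed
    have mix: ?thesis if "(r, s - r) \<in> set steps \<and> r < s \<or> (s, r - s) \<in> set steps \<and> s < r"
      "(r, t - r) \<in> set steps \<and> r < t \<or> (t, r - t) \<in> set steps \<and> t < r" "s \<noteq> t"
      "r < d" "d \<le> 20" "(20 + r - d, d) \<in> set steps" "(20 + r - d, 20 + r) \<in> set (caps M)" for s t d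
      using step[OF 2(1,2) that(1)] step[OF 2(1,2) that(2)] below[OF that(4-7)] that(3-5) 2
      by (intro exI[of _ "20 * k + s"] exI[of _ "20 * k + t"] exI[of _ "20 * k + r - d"]) auto
    have "r \<in> set [0..<20]" using 2(3) by simp
    then consider "r = 0" | "r = 1" | "r = 2" | "r = 3" | "r = 4" | "r = 5" | "r = 6" | "r = 7" | "r = 8" | "r = 9"
      | "r = 10" | "r = 11" | "r = 12" | "r = 13" | "r = 14" | "r = 15" | "r = 16" | "r = 17" | "r = 18" | "r = 19"
      by (auto simp: upt_conv_Cons)
    then show ?thesis
    proof cases
      case 1 show ?thesis by (rule mix[of 2 6 2]) (simp_all add: 1 steps_def caps_def)
    next
      case 2 show ?thesis by (rule mix[of 3 7 2]) (simp_all add: 2 steps_def caps_def)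
    next
      case 3 show ?thesis by (rule three[of 4 9 11]) (simp_all add: 3 steps_def)
    next
      case 4 show ?thesis by (rule three[of 5 8 10]) (simp_all add: 4 steps_def)
    next
      case 5 show ?thesis by (rule three[of 6 16 2]) (simp_all add: 5 steps_def)
    next
      case 6 show ?thesis by (rule three[of 7 17 3]) (simp_all add: 6 steps_def)
    next
      case 7 show ?thesis by (rule three[of 8 10 4]) (simp_all add: 7 steps_def)
    next
      case 8 show ?thesis by (rule three[of 9 11 5]) (simp_all add: 8 steps_def)
    next
      case 9 show ?thesis by (rule mix[of 6 3 16]) (simp_all add: 9 steps_def caps_def)
    next
      case 10 show ?thesis by (rule mix[of 7 2 16]) (simp_all add: 10 steps_def caps_def)
    next
      case 11 show ?thesis by (rule three[of 14 19 6]) (simp_all add: 11 steps_def)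
    next
      case 12 show ?thesis by (rule three[of 15 18 7]) (simp_all add: 12 steps_def)
    next
      case 13 show ?thesis by (rule three[of 28 14 19]) (simp_all add: 13 steps_def)
    next
      case 14 show ?thesis by (rule three[of 29 15 18]) (simp_all add: 14 steps_def)
    next
      case 15 show ?thesis by (rule three[of 20 16 12]) (simp_all add: 15 steps_def)
    next
      case 16 show ?thesis by (rule three[of 21 17 13]) (simp_all add: 16 steps_def)
    next
      case 17 show ?thesis by (rule three[of 18 14 4]) (simp_all add: 17 steps_def)
    next
      case 18 show ?thesis by (rule three[of 19 15 5]) (simp_all add: 18 steps_def)
    next
      case 19 show ?thesis by (rule three[of 20 16 13]) (simp_all add: 19 steps_def)
    next
      case 20 show ?thesis by (rule three[of 21 17 12]) (simp_all add: 20 steps_def)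
    qed
  next
    case (3 j)
    have top: "adj M (20 * M + r) (20 * M + s)" if "(r, s - r) \<in> set steps \<and> r < s \<or> (s, r - s) \<in> set steps \<and> s < r
        \<or> (20 * M + r, 20 * M + s) \<in> set (caps M) \<or> (20 * M + s, 20 * M + r) \<in> set (caps M)" for r s
      using that step[of M r s] cap M by blast
    have three: ?thesis if "adj M v (20 * M + s)" "adj M v (20 * M + t)" "adj M v (20 * M + u)" "distinct [s, t, u]" for s t u
      using that by (intro exI[of _ "20 * M + s"] exI[of _ "20 * M + t"] exI[of _ "20 * M + u"]) auto
    have v: "adj M v (20 * M + s)" if "(j, s - j) \<in> set steps \<and> j < s \<or> (s, j - s) \<in> set steps \<and> s < j
        \<or> (20 * M + j, 20 * M + s) \<in> set (caps M) \<or> (20 * M + s, 20 * M + j) \<in> set (caps M)" for s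
      using top[OF that] 3(1) by simp
    from 3(2) consider "j = 20" | "j = 21" | "j = 22" | "j = 23" | "j = 28" | "j = 29" by blast
    then show ?thesis
    proof cases
      case 1 then show ?thesis by (intro three[of 22 18 14] v) (simp_all add: steps_def caps_def)
    next
      case 2 then show ?thesis by (intro three[of 23 19 15] v) (simp_all add: steps_def caps_def)
    next
      case 3 then show ?thesis by (intro three[of 20 29 28] v) (simp_all add: steps_def caps_def)
    next
      case 4 then show ?thesis by (intro three[of 21 28 29] v) (simp_all add: steps_def caps_def)
    next
      case 5 then show ?thesis by (intro three[of 12 23 22] v) (simp_all add: steps_def caps_def)
    next
      case 6 then show ?thesis by (intro three[of 13 22 23] v) (simp_all add: steps_def caps_def)
    qed
  qed
qed

lemma min_degree_tube: "1 \<le> M \<Longrightarrow> 3 \<le> min_degree (tube M)"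
proof -
  assume M: "1 \<le> M"
  have "finite (verts (tube M))" "verts (tube M) \<noteq> {}" unfolding tube_def by auto
  moreover have "3 \<le> degree (tube M) v" if "v \<in> verts (tube M)" for v
    using tube_neighbours[OF M that] degree_tube_ge by blast
  ultimately show ?thesis unfolding min_degree_def by simp
qed

section \<open>Reduction of short cycles to five periods\<close>

definition closed_walk :: "nat \<Rightarrow> nat \<Rightarrow> (nat \<Rightarrow> nat) \<Rightarrow> bool" where
  "closed_walk M l f \<longleftrightarrow> inj_on f {..<l} \<and> (\<forall>i<l. adj M (f i) (f ((i + 1) mod l)))"

lemma contains_cycle_closed_walk:
  assumes "contains_subgraph (tube M) (cycle_graph l)"
  shows "\<exists>f. closed_walk M l f"
proof -
  obtain f where f: "inj_on f (verts (cycle_graph l))" "\<forall>e\<in>edges (cycle_graph l). f ` e \<in> edges (tube M)"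
    using assms unfolding contains_subgraph_def by blast
  have "adj M (f i) (f ((i + 1) mod l))" if "i < l" for i
  proof -
    have "{i, (i + 1) mod l} \<in> edges (cycle_graph l)" using that unfolding cycle_graph_def by auto
    then have "f ` {i, (i + 1) mod l} \<in> edges (tube M)" using f(2) by blast
    then show ?thesis by (simp add: edges_tube)
  qed
  then show ?thesis using f(1) unfolding closed_walk_def cycle_graph_def by auto
qed

lemma adj_bounds: "adj M x y \<Longrightarrow> x \<le> y + 16 \<and> y \<le> x + 16 \<and> x \<in> verts (tube M)"
  using arcs_verts unfolding adj_def by fastforce

text \<open>Of the added period only the steps (0, 2) and (1, 2) stay this low, and they are cap
  edges of the shorter tube.\<close>

lemma adj_Suc_low:
  assumes "adj (Suc M) x y" "x \<le> 20 * M + 23" "y \<le> 20 * M + 23"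
  shows "adj M x y"
proof -
  have "(x, y) \<in> arcs M" if "(x, y) \<in> arcs (Suc M)" "y \<le> 20 * M + 23" for x y
    using that(1)
  proof (cases rule: arcsE)
    case (1 k r d)
    show ?thesis
    proof (cases "k = Suc M")
      case True
      with 1 that(2) have "r + d \<le> 3" by simp
      with 1 True have "(r, d) \<in> {(0, 2), (1, 2)}" unfolding steps_def by auto
      with 1 True show ?thesis unfolding arcs_def caps_def by auto
    next
      case False
      with 1 show ?thesis unfolding arcs_def by (auto intro!: image_eqI[of _ _ "(k, r, d)"])
    qed
  next
    case 2
    then have "(x, y) \<in> set (caps M)" using that(2) unfolding caps_def by auto
    then show ?thesis unfolding arcs_def by blast
  qed
  with assms show ?thesis unfolding adj_def by blast
qed

text \<open>The bound 40 excludes the lower cap and all arcs that start in the first period. What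
  remains, the upper cap included, moves down by one period.\<close>

lemma adj_Suc_high:
  assumes "adj (Suc M) x y" "40 \<le> x" "40 \<le> y"
  shows "adj M (x - 20) (y - 20)"
proof -
  have "(x - 20, y - 20) \<in> arcs M" if "(x, y) \<in> arcs (Suc M)" "40 \<le> x" for x y
    using that(1)
  proof (cases rule: arcsE)
    case (1 k r d)
    have "k \<noteq> 1" using 1 that(2) steps_bounds[OF 1(3)] by auto
    with 1 show ?thesis unfolding arcs_def by (auto intro!: image_eqI[of _ _ "(k - 1, r, d)"] simp: algebra_simps)
  next
    case 2
    then have "(x - 20, y - 20) \<in> set (caps M)"
      using that(2) unfolding caps_def
      by (simp only: list.set, elim insertE emptyE Pair_inject) simp_all
    then show ?thesis unfolding arcs_def by blast
  qed
  with assms show ?thesis unfolding adj_def by blast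
qed

text \<open>A short closed walk either avoids the top of the tube or can be shifted down by one period.\<close>

lemma closed_walk_Suc:
  assumes f: "closed_walk (Suc M) l f" and "l \<le> 6" "5 \<le> M"
  shows "\<exists>f. closed_walk M l f"
proof -
  have inj: "inj_on f {..<l}" and adj: "\<And>i. i < l \<Longrightarrow> adj (Suc M) (f i) (f ((i + 1) mod l))"
    using f unfolding closed_walk_def by auto
  have span: "f (i + n) \<le> f i + 16 * n \<and> f i \<le> f (i + n) + 16 * n" if "i + n < l" for i n
    using that
  proof (induction n)
    case (Suc n)
    then show ?case using adj_bounds[OF adj[of "i + n"]] by simp
  qed simp
  \<comment> \<open>Indices below 6 are at most five steps apart, and each step changes the label by
    at most 16.\<close>
  have close: "f i \<le> f j + 80" if "i < l" "j < l" for i j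
  proof (cases "i \<le> j")
    case True
    then show ?thesis using span[of i "j - i"] that \<open>l \<le> 6\<close> by auto
  next
    case False
    then show ?thesis using span[of j "i - j"] that \<open>l \<le> 6\<close> by auto
  qed
  have next_lt: "(i + 1) mod l < l" if "i < l" for i using that by simp
  show ?thesis
  proof (cases "\<forall>i<l. f i \<le> 20 * M + 23")
    case True
    then have "closed_walk M l f"
      using inj adj_Suc_low[OF adj] next_lt unfolding closed_walk_def by blast
    then show ?thesis by blast
  next
    case False
    then obtain i0 where "i0 < l" "20 * M + 23 < f i0" by auto
    \<comment> \<open>All labels are at least 20 * 5 + 24 - 80 = 44; this is where five periods are
      required.\<close>
    then have high: "40 \<le> f i" if "i < l" for i using close[of i0 i] that \<open>5 \<le> M\<close> by simp
    have "inj_on (\<lambda>i. f i - 20) {..<l}"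
    proof (rule inj_onI)
      fix i j assume ij: "i \<in> {..<l}" "j \<in> {..<l}" "f i - 20 = f j - 20"
      then have "f i = f j" using high[of i] high[of j] by simp
      then show "i = j" using inj ij by (auto dest: inj_onD)
    qed
    then have "closed_walk M l (\<lambda>i. f i - 20)"
      using adj_Suc_high[OF adj] high next_lt unfolding closed_walk_def by blast
    then show ?thesis by blast
  qed
qed

section \<open>Exhaustive search in the tube with five periods\<close>

definition ups :: "nat \<Rightarrow> nat list" where
  "ups r = map snd (filter (\<lambda>(s, d). s = r) steps)"

definition downs :: "nat \<Rightarrow> nat list" where
  "downs r = map snd (filter (\<lambda>(s, d). (s + d) mod 20 = r) steps)"

lemma ups_downs_table:
  "list_all (\<lambda>(r, us, ds). ups r = us \<and> downs r = ds) [
    (0, [2, 6], [6, 2]), (1, [2, 6], [6, 2]), (2, [2, 7, 9], [2]), (3, [2, 5, 7], [2]),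
    (4, [2, 12], [2]), (5, [2, 12], [2]), (6, [2, 4], [6, 2]), (7, [2, 4], [6, 2]),
    (8, [], [5, 2, 16]), (9, [], [7, 2, 16]), (10, [4, 9], [7, 4]), (11, [4, 7], [9, 4]),
    (12, [16, 2, 7], []), (13, [16, 2, 5], []), (14, [6, 2], [4, 2]), (15, [6, 2], [4, 2]),
    (16, [2], [12, 2]), (17, [2], [12, 2]), (18, [2], [7, 5, 2]), (19, [2], [9, 7, 2])]"
  by (simp add: ups_def downs_def steps_def)

lemmas ups_downs_simps = ups_downs_table[unfolded list.pred_inject prod.case simp_thms]

text \<open>Neighbours in \<open>tube 5\<close>: steps are taken as in an infinite tube and cut down
  to the vertex set, and the four end edges of difference 6 are added by hand.\<close>

definition nbrs :: "nat \<Rightarrow> nat list" where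
  "nbrs x = filter (\<lambda>y. y \<in> {12, 13, 18, 19, 128, 129} \<or> 20 \<le> y \<and> y \<le> 123)
      (map ((+) x) (ups (x mod 20)) @ map ((-) x) (downs (x mod 20))) @
     (if x \<in> {12, 13, 122, 123} then [x + 6] else []) @
     (if x \<in> {18, 19, 128, 129} then [x - 6] else [])"

text \<open>Literal lists, computed once, so that the search only looks up constants.\<close>

lemma nbrs_table:
  "list_all (\<lambda>(x, ys). nbrs x = ys) [
    (12, [28, 19, 18]), (13, [29, 18, 19]), (18, [20, 13, 12]), (19, [21, 12, 13]),
    (20, [22, 26, 18]), (21, [23, 27, 19]), (22, [24, 29, 31, 20]), (23, [25, 28, 30, 21]),
    (24, [26, 36, 22]), (25, [27, 37, 23]), (26, [28, 30, 20, 24]), (27, [29, 31, 21, 25]),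
    (28, [23, 26, 12]), (29, [22, 27, 13]), (30, [34, 39, 23, 26]), (31, [35, 38, 22, 27]),
    (32, [48, 34, 39]), (33, [49, 35, 38]), (34, [40, 36, 30, 32]), (35, [41, 37, 31, 33]),
    (36, [38, 24, 34]), (37, [39, 25, 35]), (38, [40, 31, 33, 36]), (39, [41, 30, 32, 37]),
    (40, [42, 46, 34, 38]), (41, [43, 47, 35, 39]), (42, [44, 49, 51, 40]), (43, [45, 48, 50, 41]),
    (44, [46, 56, 42]), (45, [47, 57, 43]), (46, [48, 50, 40, 44]), (47, [49, 51, 41, 45]),
    (48, [43, 46, 32]), (49, [42, 47, 33]), (50, [54, 59, 43, 46]), (51, [55, 58, 42, 47]),
    (52, [68, 54, 59]), (53, [69, 55, 58]), (54, [60, 56, 50, 52]), (55, [61, 57, 51, 53]),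
    (56, [58, 44, 54]), (57, [59, 45, 55]), (58, [60, 51, 53, 56]), (59, [61, 50, 52, 57]),
    (60, [62, 66, 54, 58]), (61, [63, 67, 55, 59]), (62, [64, 69, 71, 60]), (63, [65, 68, 70, 61]),
    (64, [66, 76, 62]), (65, [67, 77, 63]), (66, [68, 70, 60, 64]), (67, [69, 71, 61, 65]),
    (68, [63, 66, 52]), (69, [62, 67, 53]), (70, [74, 79, 63, 66]), (71, [75, 78, 62, 67]),
    (72, [88, 74, 79]), (73, [89, 75, 78]), (74, [80, 76, 70, 72]), (75, [81, 77, 71, 73]),
    (76, [78, 64, 74]), (77, [79, 65, 75]), (78, [80, 71, 73, 76]), (79, [81, 70, 72, 77]),
    (80, [82, 86, 74, 78]), (81, [83, 87, 75, 79]), (82, [84, 89, 91, 80]), (83, [85, 88, 90, 81]),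
    (84, [86, 96, 82]), (85, [87, 97, 83]), (86, [88, 90, 80, 84]), (87, [89, 91, 81, 85]),
    (88, [83, 86, 72]), (89, [82, 87, 73]), (90, [94, 99, 83, 86]), (91, [95, 98, 82, 87]),
    (92, [108, 94, 99]), (93, [109, 95, 98]), (94, [100, 96, 90, 92]), (95, [101, 97, 91, 93]),
    (96, [98, 84, 94]), (97, [99, 85, 95]), (98, [100, 91, 93, 96]), (99, [101, 90, 92, 97]),
    (100, [102, 106, 94, 98]), (101, [103, 107, 95, 99]), (102, [104, 109, 111, 100]),
    (103, [105, 108, 110, 101]), (104, [106, 116, 102]), (105, [107, 117, 103]),
    (106, [108, 110, 100, 104]), (107, [109, 111, 101, 105]), (108, [103, 106, 92]),
    (109, [102, 107, 93]), (110, [114, 119, 103, 106]), (111, [115, 118, 102, 107]),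
    (112, [128, 114, 119]), (113, [129, 115, 118]), (114, [120, 116, 110, 112]),
    (115, [121, 117, 111, 113]), (116, [118, 104, 114]), (117, [119, 105, 115]),
    (118, [120, 111, 113, 116]), (119, [121, 110, 112, 117]), (120, [122, 114, 118]),
    (121, [123, 115, 119]), (122, [129, 120, 128]), (123, [128, 121, 129]), (128, [123, 112, 122]),
    (129, [122, 113, 123])]"
  by (simp add: nbrs_def ups_downs_simps del: One_nat_def)

lemmas nbrs_simps = nbrs_table[unfolded list.pred_inject prod.case simp_thms]

text \<open>It suffices to search a hexagon from its smallest vertex, as two paths of length 3.\<close>

definition paths3 :: "nat \<Rightarrow> (nat \<times> nat \<times> nat) list" where
  "paths3 v = concat (map (\<lambda>a. concat (map (\<lambda>b. map (\<lambda>c. (a, b, c)) (filter (\<lambda>c. c \<noteq> a \<and> v < c) (nbrs b)))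
     (filter (\<lambda>b. v < b) (nbrs a)))) (filter (\<lambda>a. v < a) (nbrs v)))"

lemma set_paths3:
  "set (paths3 v) = {(a, b, c). a \<in> set (nbrs v) \<and> b \<in> set (nbrs a) \<and> c \<in> set (nbrs b) \<and>
    v < a \<and> v < b \<and> v < c \<and> c \<noteq> a}"
  unfolding paths3_def by (auto simp: image_iff)

text \<open>The alternatives are all possible coincidences between inner vertices of two paths with
  the same end. A hexagon with smallest vertex \<open>v\<close> would supply two paths with none of
  them.\<close>

definition hexfree :: "nat \<Rightarrow> bool" where
  "hexfree v \<longleftrightarrow> list_all (\<lambda>(a, b, c). list_all (\<lambda>(a', b', c'). c = c' \<longrightarrow> a = a' \<or> b = b' \<or> a = b' \<or> b = a') (paths3 v)) (paths3 v)"

lemma adj_nbrs: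
  assumes "adj 5 x y"
  shows "y \<in> set (nbrs x)"
proof -
  have V: "z \<in> {12, 13, 18, 19, 128, 129} \<or> 20 \<le> z \<and> z \<le> 123" if "z \<in> verts (tube 5)" for z
    using that unfolding tube_def by auto
  have main: "y \<in> set (nbrs x) \<and> x \<in> set (nbrs y)" if xy: "(x, y) \<in> arcs 5" for x y
    using xy
  proof (cases rule: arcsE)
    case (1 k r d)
    have mem: "x \<in> {12, 13, 18, 19, 128, 129} \<or> 20 \<le> x \<and> x \<le> 123"
      "y \<in> {12, 13, 18, 19, 128, 129} \<or> 20 \<le> y \<and> y \<le> 123"
      using V[of x] V[of y] arcs_verts[OF xy] by blast+
    have "x mod 20 = r" "y mod 20 = (r + d) mod 20"
      using 1 steps_bounds[OF 1(3)] by (simp_all add: add.assoc)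
    then have F: "d \<in> set (ups (x mod 20))" "d \<in> set (downs (y mod 20))"
      using 1(3) unfolding ups_def downs_def set_map by (auto intro!: image_eqI[of _ _ "(r, d)"])
    have eq: "y = x + d" "x = y - d" using 1(4,5) by auto
    have "y \<in> set (map ((+) x) (ups (x mod 20)))"
      unfolding set_map by (rule image_eqI[of _ _ d]) (rule eq(1), rule F(1))
    moreover have "x \<in> set (map ((-) y) (downs (y mod 20)))"
      unfolding set_map by (rule image_eqI[of _ _ d]) (rule eq(2), rule F(2))
    ultimately show ?thesis
      by (simp only: nbrs_def set_append set_filter Un_iff mem_Collect_eq mem simp_thms)
  next
    case 2
    then show ?thesis unfolding caps_def by (auto simp: nbrs_simps)
  qed
  show ?thesis using assms main unfolding adj_def by blast
qed

lemma tube_5_checks: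
  assumes "v \<in> verts (tube 5)"
  shows "hexfree v" "list_all (\<lambda>a. list_all (\<lambda>b. b = v \<or> v \<notin> set (nbrs b)) (nbrs a)) (nbrs v)"
proof -
  have v: "v \<in> set ([12, 13, 18, 19] @ [20..<124] @ [128, 129])"
    using assms unfolding tube_def set_append set_upt by auto
  have "list_all hexfree ([12, 13, 18, 19] @ [20..<124] @ [128, 129])"
    by (simp add: hexfree_def paths3_def nbrs_simps)
  then show "hexfree v" using v unfolding list_all_iff by blast
  have "list_all (\<lambda>v. list_all (\<lambda>a. list_all (\<lambda>b. b = v \<or> v \<notin> set (nbrs b)) (nbrs a)) (nbrs v))
      ([12, 13, 18, 19] @ [20..<124] @ [128, 129])"
    by (simp add: nbrs_simps)
  then show "list_all (\<lambda>a. list_all (\<lambda>b. b = v \<or> v \<notin> set (nbrs b)) (nbrs a)) (nbrs v)"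
    using v unfolding list_all_iff by blast
qed

lemma no_closed_walk_3: "\<not> closed_walk 5 3 f"
proof
  assume "closed_walk 5 3 f"
  then have inj: "inj_on f {..<3}" and adj: "\<And>i. i < 3 \<Longrightarrow> adj 5 (f i) (f ((i + 1) mod 3))"
    unfolding closed_walk_def by auto
  have "f 2 \<noteq> f 0" using inj_onD[OF inj, of 2 0] by auto
  moreover have "f 1 \<in> set (nbrs (f 0))" "f 2 \<in> set (nbrs (f 1))" "f 0 \<in> set (nbrs (f 2))"
    using adj_nbrs[OF adj[of 0]] adj_nbrs[OF adj[of 1]] adj_nbrs[OF adj[of 2]] by (simp_all add: numeral_2_eq_2)
  moreover have "f 0 \<in> verts (tube 5)" using adj_bounds[OF adj[of 0]] by simp
  ultimately show False
    using tube_5_checks(2)[of "f 0"] unfolding list_all_iff by blast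
qed

lemma closed_walk_rotate:
  assumes "closed_walk M l f" "i < l"
  shows "closed_walk M l (\<lambda>j. f ((j + i) mod l))"
proof -
  have inj: "inj_on f {..<l}" and adj: "\<And>j. j < l \<Longrightarrow> adj M (f j) (f ((j + 1) mod l))"
    using assms(1) unfolding closed_walk_def by auto
  have "inj_on (\<lambda>j. f ((j + i) mod l)) {..<l}"
  proof (rule inj_onI)
    fix j k assume jk: "j \<in> {..<l}" "k \<in> {..<l}" "f ((j + i) mod l) = f ((k + i) mod l)"
    then have "(j + i) mod l = (k + i) mod l"
      using inj_onD[OF inj jk(3)] by simp
    moreover have "(j + i) mod l = (if j + i < l then j + i else j + i - l)"
      "(k + i) mod l = (if k + i < l then k + i else k + i - l)"
      using jk assms(2) by (simp_all add: le_mod_geq)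
    ultimately show "j = k" using jk assms(2) by (auto split: if_splits)
  qed
  moreover have "adj M (f ((j + i) mod l)) (f (((j + 1) mod l + i) mod l))" if "j < l" for j
    using adj[of "(j + i) mod l"] that by (simp add: mod_simps)
  ultimately show ?thesis unfolding closed_walk_def by simp
qed

lemma no_closed_walk_6: "\<not> closed_walk 5 6 f"
proof
  assume f0: "closed_walk 5 6 f"
  have "Min (f ` {..<6}) \<in> f ` {..<6}" by (intro Min_in) (auto simp: lessThan_empty_iff)
  then obtain i where i: "i < 6" "f i = Min (f ` {..<6})" by auto
  \<comment> \<open>The rotation puts the smallest vertex first, so that
    \<open>g 0 g 1 g 2 g 3\<close> and \<open>g 0 g 5 g 4 g 3\<close> satisfy the strict
    inequalities built into \<open>paths3\<close>.\<close>
  define g where "g j = f ((j + i) mod 6)" for j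
  have "closed_walk 5 6 g" unfolding g_def by (rule closed_walk_rotate[OF f0 i(1)])
  then have inj: "inj_on g {..<6}" and adj: "\<And>i. i < 6 \<Longrightarrow> adj 5 (g i) (g ((i + 1) mod 6))"
    unfolding closed_walk_def by auto
  have ne: "g i \<noteq> g j" if "i < 6" "j < 6" "i \<noteq> j" for i j
    using inj_onD[OF inj, of i j] that by auto
  have "g 0 \<le> g j" for j
    using i unfolding g_def by simp
  then have less: "g 0 < g j" if "0 < j" "j < 6" for j
    using ne[of 0 j] that by (simp add: order.not_eq_order_implies_strict)
  have fwd: "g 1 \<in> set (nbrs (g 0))" "g 2 \<in> set (nbrs (g 1))" "g 3 \<in> set (nbrs (g 2))"
    using adj_nbrs[OF adj[of 0]] adj_nbrs[OF adj[of 1]] adj_nbrs[OF adj[of 2]]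
    by (simp_all flip: numeral_2_eq_2)
  have bwd: "g 3 \<in> set (nbrs (g 4))" "g 4 \<in> set (nbrs (g 5))" "g 5 \<in> set (nbrs (g 0))"
    using adj_nbrs[OF adj_sym[THEN iffD1, OF adj[of 3]]] adj_nbrs[OF adj_sym[THEN iffD1, OF adj[of 4]]]
      adj_nbrs[OF adj_sym[THEN iffD1, OF adj[of 5]]] by simp_all
  have "(g 1, g 2, g 3) \<in> set (paths3 (g 0))" "(g 5, g 4, g 3) \<in> set (paths3 (g 0))"
    using fwd bwd ne[of 3 1] ne[of 3 5] less by (simp_all add: set_paths3)
  moreover have "g 0 \<in> verts (tube 5)" using adj_bounds[OF adj[of 0]] by simp
  then have "hexfree (g 0)" by (rule tube_5_checks)
  ultimately have "g 1 = g 5 \<or> g 2 = g 4 \<or> g 1 = g 4 \<or> g 2 = g 5"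
    unfolding hexfree_def list_all_iff by fastforce
  then show False using ne by auto
qed

lemma tube_cycle_free:
  assumes "5 \<le> M" "l = 3 \<or> l = 6"
  shows "subgraph_free (cycle_graph l) (tube M)"
proof -
  have "\<not> closed_walk M l f" for f
    using assms(1)
  proof (induction M arbitrary: f rule: dec_induct)
    case base
    then show ?case using assms(2) no_closed_walk_3 no_closed_walk_6 by blast
  next
    case (step M)
    then show ?case using closed_walk_Suc[of M l f] assms(2) by auto
  qed
  then show ?thesis
    unfolding subgraph_free_def using contains_cycle_closed_walk by blast
qed

lemma tube_extremal:
  "int (card (edges (tube M))) = \<lfloor>(9 / 5 :: real) * real (card (verts (tube M))) - 4\<rfloor>"
proof -
  have "(9 / 5 :: real) * real (20 * M + 10) - 4 = of_int (int (36 * M + 14))" by simp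
  then show ?thesis unfolding card_verts_tube card_edges_tube by (simp only: floor_of_int)
qed

lemma infinitely_many_extremal:
  "infinite {n :: nat. \<exists>G :: nat ugraph.
      simple_graph G \<and> verts G \<noteq> {} \<and> planar G \<and>
      subgraph_free (cycle_graph 6) G \<and> subgraph_free (cycle_graph 3) G \<and>
      min_degree G \<ge> 3 \<and> card (verts G) = n \<and>
      int (card (edges G)) = \<lfloor>(9 / 5 :: real) * real n - 4\<rfloor>}" (is "infinite ?N")
proof -
  have "20 * M + 10 \<in> ?N" if M: "5 \<le> M" for M
  proof -
    have "verts (tube M) \<noteq> {}" unfolding tube_def by auto
    then show ?thesis
      using simple_tube planar_tube tube_cycle_free[OF M] min_degree_tube[of M] M
        tube_extremal[of M] card_verts_tube[of M]
      by (intro CollectI exI[of _ "tube M"]) simp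
  qed
  then have "(\<lambda>M. 20 * M + 10) ` {5..} \<subseteq> ?N" by blast
  moreover have "infinite ((\<lambda>M. 20 * M + 10 :: nat) ` {5..})"
    by (subst finite_image_iff) (auto simp: inj_on_def infinite_Ici)
  ultimately show ?thesis using infinite_super by blast
qed

theorem theorem1p5:
  "(\<forall>G :: 'a ugraph.
      simple_graph G \<and> verts G \<noteq> {} \<and> planar G \<and>
      subgraph_free (cycle_graph 6) G \<and> subgraph_free (cycle_graph 3) G \<and>
      min_degree G \<ge> 3 \<longrightarrow>
      int (card (edges G)) \<le> \<lfloor>(9 / 5 :: real) * real (card (verts G)) - 4\<rfloor>) \<and>
   infinite {n :: nat. \<exists>G :: nat ugraph.
      simple_graph G \<and> verts G \<noteq> {} \<and> planar G \<and>
      subgraph_free (cycle_graph 6) G \<and> subgraph_free (cycle_graph 3) G \<and>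
      min_degree G \<ge> 3 \<and> card (verts G) = n \<and>
      int (card (edges G)) = \<lfloor>(9 / 5 :: real) * real n - 4\<rfloor>}"
proof (intro conjI allI impI)
  fix G :: "'a ugraph"
  assume "simple_graph G \<and> verts G \<noteq> {} \<and> planar G \<and>
    subgraph_free (cycle_graph 6) G \<and> subgraph_free (cycle_graph 3) G \<and> min_degree G \<ge> 3"
  then show "int (card (edges G)) \<le> \<lfloor>(9 / 5 :: real) * real (card (verts G)) - 4\<rfloor>"
    by (intro planar_edge_bound) simp_all
qed (rule infinitely_many_extremal)

end
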